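(* The map $$K\times_{N_0}\mathcal{Y}'\to\mathcal{X}',\qquad [k,[Y]]\mapsto k\cdot W_Y$$ is a $K$-equivariant continuous bijection. In particular $\mathcal{X}'$ carries a natural structure of a smooth 5-dimensional $K$-manifold.
   Context: Let $\mathfrak{p}$ be the (5-dimensional) space of real symmetric trace-free $3\times3$-matrices, on which $K=\mathrm{SO}(3,\mathbb{R})$ acts by conjugation $k\cdot X=kXk^{-1}$; $K$ then acts on the Grassmannian $\mathrm{Gr}_2(\mathfrak{p})$ of 2-dimensional real subspaces of $\mathfrak{p}$. Let $\mathcal{X}=\{W\in\mathrm{Gr}_2(\mathfrak{p})\mid K\cdot W=\mathfrak{p}\}$, where $K\cdot W=\{k\cdot X\mid k\in K,X\in W\}$. Let $X_0=\operatorname{diag}(1,1,-2)$ and, for $Y\in\mathfrak{p}\setminus\mathbb{R}X_0$, let $W_Y=\operatorname{span}_{\mathbb{R}}\{X_0,Y\}\in \mathrm{Gr}_2(\mathfrak{p})$. For $(\alpha,\delta,\epsilon)\in\mathbb{R}^3$ set $$Y_{\alpha,\delta,\epsilon}=\begin{pmatrix}\alpha&0&\delta\\0&-\alpha&\epsilon\\\delta&\epsilon&0\end{pmatrix}.$$ Let $\mathcal{Y}$ be the 2-dimensional real projective space of lines $[Y_{\alpha,\delta,\epsilon}]=\mathbb{R}Y_{\alpha,\delta,\epsilon}$ with $(\alpha,\delta,\epsilon)\ne(0,0,0)$ (note that $W_Y$ depends only on $[Y]$), and let $$\mathcal{Y}'=\{[Y_{\alpha,\delta,\epsilon}]\in\mathcal{Y}\mid\alpha\neq0,\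 \delta\neq0,\ \epsilon\neq0\}.$$ Let $N_0\subset K$ be the subgroup of order 8 generated by $$s_0=\begin{pmatrix}0&1&0\\-1&0&0\\0&0&1\end{pmatrix},\qquad m_2=\begin{pmatrix}1&0&0\\0&-1&0\\0&0&-1\end{pmatrix}.$$ By conjugation $N_0$ acts on $\mathcal{Y}$ and preserves $\mathcal{Y}'$, and $k\cdot W_Y=W_{k\cdot Y}$ for $k\in N_0$. $K\times_{N_0}\mathcal{Y}'$ denotes the quotient of $K\times\mathcal{Y}'$ by the equivalence relation $(kn,[Y])\sim(k,[n\cdot Y])$, $n\in N_0$, with $K$ acting by left multiplication on the first factor; the class of $(k,[Y])$ is written $[k,[Y]]$. Finally $\mathcal{X}'=\{k\cdot W_Y\mid k\in K,\ [Y]\in\mathcal{Y}'\}\subset\mathcal{X}$, with the topology induced from $\mathrm{Gr}_2(\mathfrak{p})$. The natural manifold structure on $\mathcal{X}'$ is the one transported from $K\times_{N_0}\mathcal{Y}'$ by the bijection. *)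

theory Defs
  imports "HOL-Analysis.Analysis" "HOL-Algebra.Generated_Groups"
begin

section \<open>Smooth manifolds\<close>

text \<open>The quotient topology on \<open>f ` topspace T\<close>; for injective \<open>f\<close> this is the topology
  transported along \<open>f\<close>.\<close>

definition quotient_topology :: "'a topology \<Rightarrow> ('a \<Rightarrow> 'b) \<Rightarrow> 'b topology" where
  "quotient_topology T f =
     topology (\<lambda>V. V \<subseteq> f ` topspace T \<and> openin T {x \<in> topspace T. f x \<in> V})"

lemma openin_quotient_topology:
  "openin (quotient_topology T f) V \<longleftrightarrow>
     V \<subseteq> f ` topspace T \<and> openin T {x \<in> topspace T. f x \<in> V}"
proof -
  have "istopology (\<lambda>V. V \<subseteq> f ` topspace T \<and> openin T {x \<in> topspace T. f x \<in> V})"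
    unfolding istopology_def
  proof (rule conjI; intro allI impI)
    fix S U assume S: "S \<subseteq> f ` topspace T \<and> openin T {x \<in> topspace T. f x \<in> S}"
      and U: "U \<subseteq> f ` topspace T \<and> openin T {x \<in> topspace T. f x \<in> U}"
    have "{x \<in> topspace T. f x \<in> S \<inter> U} =
        {x \<in> topspace T. f x \<in> S} \<inter> {x \<in> topspace T. f x \<in> U}" by blast
    also have "openin T \<dots>" by (rule openin_Int[OF conjunct2[OF S] conjunct2[OF U]])
    finally show "S \<inter> U \<subseteq> f ` topspace T \<and> openin T {x \<in> topspace T. f x \<in> S \<inter> U}"
      using S by blast
  next
    fix \<K> assume K: "\<forall>S\<in>\<K>. S \<subseteq> f ` topspace T \<and> openin T {x \<in> topspace T. f x \<in> S}"
    have "{x \<in> topspace T. f x \<in> \<Union>\<K>} = (\<Union>S\<in>\<K>. {x \<in> topspace T. f x \<in> S})" by blast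
    also have "openin T \<dots>" by (rule openin_Union) (use K in blast)
    finally show "\<Union>\<K> \<subseteq> f ` topspace T \<and> openin T {x \<in> topspace T. f x \<in> \<Union>\<K>}"
      using K by blast
  qed
  then show ?thesis unfolding quotient_topology_def by (simp only: topology_inverse')
qed

lemma topspace_quotient_topology: "topspace (quotient_topology T f) = f ` topspace T"
proof (rule subset_antisym)
  show "topspace (quotient_topology T f) \<subseteq> f ` topspace T"
    by (rule conjunct1[OF iffD1[OF openin_quotient_topology openin_topspace]])
  have "{x \<in> topspace T. f x \<in> f ` topspace T} = topspace T" by blast
  then have "openin T {x \<in> topspace T. f x \<in> f ` topspace T}" by (simp only: openin_topspace)
  then have "openin (quotient_topology T f) (f ` topspace T)"
    by (intro iffD2[OF openin_quotient_topology] conjI subset_refl)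
  then show "f ` topspace T \<subseteq> topspace (quotient_topology T f)"
    by (rule openin_subset)
qed

text \<open>\<open>C\<^sup>k\<close> on an open set, by iterated directional derivatives along the standard basis.\<close>

fun Ck_on :: "nat \<Rightarrow> 'a::euclidean_space set \<Rightarrow> ('a \<Rightarrow> 'b::euclidean_space) \<Rightarrow> bool" where
  "Ck_on 0 S f \<longleftrightarrow> continuous_on S f"
| "Ck_on (Suc k) S f \<longleftrightarrow>
     f differentiable_on S \<and> (\<forall>b\<in>Basis. Ck_on k S (\<lambda>x. frechet_derivative f (at x) b))"

text \<open>On an arbitrary set, smooth means: locally the restriction of a \<open>C\<^sup>\<infinity>\<close> function defined on an
  open subset of the ambient space. If \<open>S\<close> is open this is just \<open>C\<^sup>\<infinity>\<close>.\<close>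

definition smooth_on :: "'a::euclidean_space set \<Rightarrow> ('a \<Rightarrow> 'b::euclidean_space) \<Rightarrow> bool" where
  "smooth_on S f \<longleftrightarrow>
     (\<forall>x\<in>S. \<exists>U g. open U \<and> x \<in> U \<and> (\<forall>k. Ck_on k U g) \<and> (\<forall>y\<in>S \<inter> U. g y = f y))"

text \<open>A chart is a pair of a domain and a coordinate map, the values of the latter outside the
  domain being irrelevant.\<close>

type_synonym ('m, 'e) chart = "'m set \<times> ('m \<Rightarrow> 'e)"

definition smooth_atlas :: "'m topology \<Rightarrow> ('m, 'e::euclidean_space) chart set \<Rightarrow> bool" where
  "smooth_atlas T A \<longleftrightarrow>
     (\<forall>(U, \<phi>)\<in>A. openin T U \<and> open (\<phi> ` U) \<and>
        homeomorphic_map (subtopology T U) (top_of_set (\<phi> ` U)) \<phi>) \<and>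
     (\<Union>(U, \<phi>)\<in>A. U) = topspace T \<and>
     (\<forall>(U, \<phi>)\<in>A. \<forall>(V, \<psi>)\<in>A. smooth_on (\<phi> ` (U \<inter> V)) (\<psi> \<circ> inv_into U \<phi>))"

definition smooth_manifold :: "nat \<Rightarrow> 'm topology \<Rightarrow> ('m, 'e::euclidean_space) chart set \<Rightarrow> bool" where
  "smooth_manifold n T A \<longleftrightarrow>
     DIM('e) = n \<and> Hausdorff_space T \<and> second_countable T \<and> smooth_atlas T A"

definition smooth_map ::
  "'m topology \<Rightarrow> ('m, 'e::euclidean_space) chart set \<Rightarrow>
   'n topology \<Rightarrow> ('n, 'f::euclidean_space) chart set \<Rightarrow> ('m \<Rightarrow> 'n) \<Rightarrow> bool" where
  "smooth_map T A T' A' f \<longleftrightarrow>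
     continuous_map T T' f \<and>
     (\<forall>(U, \<phi>)\<in>A. \<forall>(V, \<psi>)\<in>A'. smooth_on (\<phi> ` (U \<inter> f -` V)) (\<psi> \<circ> f \<circ> inv_into U \<phi>))"

definition prod_atlas ::
  "('m, 'e) chart set \<Rightarrow> ('n, 'f) chart set \<Rightarrow> ('m \<times> 'n, 'e \<times> 'f) chart set" where
  "prod_atlas A B = {(U \<times> V, map_prod \<phi> \<psi>) | U \<phi> V \<psi>. (U, \<phi>) \<in> A \<and> (V, \<psi>) \<in> B}"

definition restrict_atlas :: "('m, 'e) chart set \<Rightarrow> 'm set \<Rightarrow> ('m, 'e) chart set" where
  "restrict_atlas A S = {(U \<inter> S, \<phi>) | U \<phi>. (U, \<phi>) \<in> A}"

text \<open>The charts of a submanifold \<open>S\<close> of Euclidean space: all diffeomorphisms from relatively open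
  subsets of \<open>S\<close> onto open subsets of the model space.\<close>

definition submanifold_atlas :: "'a::euclidean_space set \<Rightarrow> ('a, 'e::euclidean_space) chart set" where
  "submanifold_atlas S = {(U, \<phi>). openin (top_of_set S) U \<and> open (\<phi> ` U) \<and> inj_on \<phi> U \<and>
     smooth_on U \<phi> \<and> smooth_on (\<phi> ` U) (inv_into U \<phi>)}"

text \<open>The atlas that makes \<open>f\<close> a local diffeomorphism: charts restricted to open sets on which \<open>f\<close> is
  injective, composed with the local inverse of \<open>f\<close>. It is used for the quotient by a free action of
  a finite group, where \<open>f\<close> is the projection, and for transport along a bijection \<open>f\<close>.\<close>

definition pushforward_atlas ::
  "'m topology \<Rightarrow> ('m, 'e) chart set \<Rightarrow> ('m \<Rightarrow> 'n) \<Rightarrow> ('n, 'e) chart set" where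
  "pushforward_atlas T A f = {(f ` U', \<phi> \<circ> inv_into U' f) | U U' \<phi>.
     (U, \<phi>) \<in> A \<and> U' \<subseteq> U \<and> openin T U' \<and> inj_on f U'}"

section \<open>The rotation group and the Grassmannian of planes of trace-free symmetric matrices\<close>

type_synonym mat3 = "real^3^3"

definition SO3 :: "mat3 set" where
  "SO3 = {k. orthogonal_matrix k \<and> det k = 1}"

definition SO3_group :: "mat3 monoid" where
  "SO3_group = \<lparr>carrier = SO3, mult = (**), one = mat 1\<rparr>"

definition SO3_topology :: "mat3 topology" where
  "SO3_topology = top_of_set SO3"

definition SO3_atlas :: "(mat3, real^3) chart set" where
  "SO3_atlas = submanifold_atlas SO3"

definition smooth_SO3_manifold ::
  "nat \<Rightarrow> 'm topology \<Rightarrow> ('m, 'e::euclidean_space) chart set \<Rightarrow> (mat3 \<Rightarrow> 'm \<Rightarrow> 'm) \<Rightarrow> bool" where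
  "smooth_SO3_manifold n T A act \<longleftrightarrow>
     smooth_manifold n T A \<and>
     (\<forall>k\<in>SO3. \<forall>x\<in>topspace T. act k x \<in> topspace T) \<and>
     (\<forall>x\<in>topspace T. act (mat 1) x = x) \<and>
     (\<forall>k\<in>SO3. \<forall>l\<in>SO3. \<forall>x\<in>topspace T. act (k ** l) x = act k (act l x)) \<and>
     smooth_map (prod_topology SO3_topology T) (prod_atlas SO3_atlas A) T A (\<lambda>(k, x). act k x)"

definition \<pp> :: "mat3 set" where
  "\<pp> = {X. transpose X = X \<and> trace X = 0}"

definition conj_mat :: "mat3 \<Rightarrow> mat3 \<Rightarrow> mat3" where
  "conj_mat k X = k ** X ** matrix_inv k"

text \<open>The induced action on subsets of \<open>\<pp>\<close>, in particular on planes and on lines.\<close>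

definition conj_set :: "mat3 \<Rightarrow> mat3 set \<Rightarrow> mat3 set" where
  "conj_set k W = conj_mat k ` W"

definition Gr2 :: "mat3 set set" where
  "Gr2 = {W. subspace W \<and> W \<subseteq> \<pp> \<and> dim W = 2}"

text \<open>The quotient topology from the space of ordered bases of planes.\<close>

definition Gr2_topology :: "mat3 set topology" where
  "Gr2_topology = quotient_topology
     (top_of_set {(X, Y). X \<in> \<pp> \<and> Y \<in> \<pp> \<and> X \<noteq> Y \<and> independent {X, Y}})
     (\<lambda>(X, Y). span {X, Y})"

lemma subspace_\<pp>: "subspace \<pp>"
  unfolding subspace_def \<pp>_def
proof (intro conjI ballI allI)
  fix X Y :: mat3 and c :: real
  assume X: "X \<in> {X. transpose X = X \<and> trace X = 0}"
  then have "\<And>i j. X $ j $ i = X $ i $ j" by (simp add: transpose_def vec_eq_iff)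
  then have "transpose (c *\<^sub>R X) = c *\<^sub>R X" by (simp add: transpose_def vec_eq_iff)
  moreover have "trace (c *\<^sub>R X) = c * trace X" by (simp add: trace_def sum_distrib_left)
  ultimately show "c *\<^sub>R X \<in> {X. transpose X = X \<and> trace X = 0}" using X by simp
  assume "Y \<in> {X. transpose X = X \<and> trace X = 0}"
  with X show "X + Y \<in> {X. transpose X = X \<and> trace X = 0}"
    by (simp add: transpose_def vec_eq_iff trace_add)
qed (simp add: transpose_def vec_eq_iff trace_def)

lemma topspace_Gr2_topology: "topspace Gr2_topology = Gr2"
proof (intro equalityI subsetI)
  fix W assume "W \<in> topspace Gr2_topology"
  then obtain X Y where *: "X \<in> \<pp>" "Y \<in> \<pp>" "X \<noteq> Y" "independent {X, Y}" "W = span {X, Y}"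
    by (auto simp: Gr2_topology_def topspace_quotient_topology)
  have "dim W = card {X, Y}" unfolding *(5) dim_span by (rule dim_eq_card_independent[OF *(4)])
  moreover have "W \<subseteq> \<pp>" using *(1,2,5) by (simp add: span_minimal subspace_\<pp>)
  ultimately show "W \<in> Gr2" using *(3,5) by (simp add: Gr2_def)
next
  fix W assume "W \<in> Gr2"
  then have W: "subspace W" "W \<subseteq> \<pp>" "dim W = 2" by (simp_all add: Gr2_def)
  obtain B where B: "B \<subseteq> W" "independent B" "W \<subseteq> span B" "card B = dim W"
    by (rule basis_exists)
  obtain X Y where XY: "B = {X, Y}" "X \<noteq> Y" using B(4) W(3) by (auto simp: card_2_iff)
  have "span B \<subseteq> W" using B(1) W(1) by (rule span_minimal)
  then have "W = span {X, Y}" using B(3) XY(1) by simp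
  moreover have "X \<in> \<pp>" "Y \<in> \<pp>" using B(1) W(2) XY(1) by auto
  ultimately show "W \<in> topspace Gr2_topology"
    unfolding Gr2_topology_def topspace_quotient_topology
    using B(2) XY by (intro image_eqI[where x = "(X, Y)"]) simp_all
qed

section \<open>The slice and the twisted product\<close>

definition X0 :: mat3 where
  "X0 = vector [vector [1, 0, 0], vector [0, 1, 0], vector [0, 0, -2]]"

definition W_of :: "mat3 \<Rightarrow> mat3 set" where
  "W_of Y = span {X0, Y}"

definition Y_mat :: "real \<Rightarrow> real \<Rightarrow> real \<Rightarrow> mat3" where
  "Y_mat \<alpha> \<delta> \<epsilon> = vector [vector [\<alpha>, 0, \<delta>], vector [0, -\<alpha>, \<epsilon>], vector [\<delta>, \<epsilon>, 0]]"

definition line :: "mat3 \<Rightarrow> mat3 set" where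
  "line Y = span {Y}"

definition \<Y> :: "mat3 set set" where
  "\<Y> = {line (Y_mat \<alpha> \<delta> \<epsilon>) | \<alpha> \<delta> \<epsilon>. (\<alpha>, \<delta>, \<epsilon>) \<noteq> (0, 0, 0)}"

definition \<Y>_topology :: "mat3 set topology" where
  "\<Y>_topology =
     quotient_topology (top_of_set {Y_mat \<alpha> \<delta> \<epsilon> | \<alpha> \<delta> \<epsilon>. (\<alpha>, \<delta>, \<epsilon>) \<noteq> (0, 0, 0)}) line"

text \<open>The three standard affine charts of the projective plane, each given as the inverse of an
  injective parametrization.\<close>

definition \<Y>_atlas :: "(mat3 set, real \<times> real) chart set" where
  "\<Y>_atlas = (\<lambda>p. (range p, inv_into UNIV p)) `
     {\<lambda>(s, t). line (Y_mat 1 s t), \<lambda>(s, t). line (Y_mat s 1 t), \<lambda>(s, t). line (Y_mat s t 1)}"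

definition \<Y>' :: "mat3 set set" where
  "\<Y>' = {line (Y_mat \<alpha> \<delta> \<epsilon>) | \<alpha> \<delta> \<epsilon>. \<alpha> \<noteq> 0 \<and> \<delta> \<noteq> 0 \<and> \<epsilon> \<noteq> 0}"

definition s0 :: mat3 where
  "s0 = vector [vector [0, 1, 0], vector [-1, 0, 0], vector [0, 0, 1]]"

definition m2 :: mat3 where
  "m2 = vector [vector [1, 0, 0], vector [0, -1, 0], vector [0, 0, -1]]"

definition N0 :: "mat3 set" where
  "N0 = generate SO3_group {s0, m2}"

definition twist_rel :: "((mat3 \<times> mat3 set) \<times> (mat3 \<times> mat3 set)) set" where
  "twist_rel = {((k ** n, L), (k, conj_set n L)) | k n L. k \<in> SO3 \<and> n \<in> N0 \<and> L \<in> \<Y>'}"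

definition twist_class :: "mat3 \<Rightarrow> mat3 set \<Rightarrow> (mat3 \<times> mat3 set) set" where
  "twist_class k L = twist_rel `` {(k, L)}"

definition twist_prod :: "(mat3 \<times> mat3 set) set set" where
  "twist_prod = (SO3 \<times> \<Y>') // twist_rel"

definition twist_act :: "mat3 \<Rightarrow> (mat3 \<times> mat3 set) set \<Rightarrow> (mat3 \<times> mat3 set) set" where
  "twist_act k c = (\<lambda>(l, L). (k ** l, L)) ` c"

definition pre_twist_topology :: "(mat3 \<times> mat3 set) topology" where
  "pre_twist_topology = prod_topology SO3_topology (subtopology \<Y>_topology \<Y>')"

definition twist_topology :: "(mat3 \<times> mat3 set) set topology" where
  "twist_topology = quotient_topology pre_twist_topology (\<lambda>(k, L). twist_class k L)"

definition twist_atlas :: "((mat3 \<times> mat3 set) set, (real^3) \<times> (real \<times> real)) chart set" where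
  "twist_atlas = pushforward_atlas pre_twist_topology
     (prod_atlas SO3_atlas (restrict_atlas \<Y>_atlas \<Y>')) (\<lambda>(k, L). twist_class k L)"

definition \<X>' :: "mat3 set set" where
  "\<X>' = {conj_set k (W_of Y) | k Y. k \<in> SO3 \<and> line Y \<in> \<Y>'}"

definition twist_map :: "(mat3 \<times> mat3 set) set \<Rightarrow> mat3 set" where
  "twist_map c = (THE W. \<exists>k\<in>SO3. \<exists>Y. line Y \<in> \<Y>' \<and> c = twist_class k (line Y) \<and>
     W = conj_set k (W_of Y))"

text \<open>The manifold structure transported to \<open>\<X>'\<close>. Its topology is the transported one, which is not
  assumed to be the one induced from the Grassmannian.\<close>

definition \<X>'_topology :: "mat3 set topology" where
  "\<X>'_topology = quotient_topology twist_topology twist_map"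

definition \<X>'_atlas :: "(mat3 set, (real^3) \<times> (real \<times> real)) chart set" where
  "\<X>'_atlas = pushforward_atlas twist_topology twist_atlas twist_map"

end

theory Submission
  imports Defs
begin

text \<open>
  The map \<open>[k, [Y]] \<mapsto> k \<cdot> W_Y\<close> is injective because \<open>X0\<close> can be recovered from the plane \<open>W_Y\<close>: if \<open>\<delta>\<close> and
  \<open>\<epsilon>\<close> do not vanish, the only conjugate of \<open>X0\<close> lying in \<open>W_Y\<close> is \<open>X0\<close> itself.
  A rotation carrying one such plane to another therefore fixes \<open>X0\<close>, so it preserves the
  third axis, and it carries the orthogonal complement of \<open>X0\<close> in one plane to that in the other. If
  \<open>\<alpha>\<close> does not vanish, the upper left blocks \<open>diag(\<alpha>, -\<alpha>)\<close> have distinct eigenvalues, and a rotation matching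
  them is a signed permutation of the first two axes, that is, an element of \<open>N0\<close>. This is
  \<open>conj_plane_eq_imp_N0\<close>. As a consequence \<open>twist_rel\<close> is the kernel of \<open>(k, [Y]) \<mapsto> k \<cdot> W_Y\<close>
  (\<open>twist_rel_eq\<close>), and the bijection and its equivariance follow formally.

  For the manifold structure, \<open>\<Y>'\<close> is identified with an open subset \<open>quadrants\<close> of the real plane by
  normalizing \<open>\<alpha> = 1\<close>. Then \<open>\<X>'\<close> with the transported topology is the quotient of \<open>SO3 \<times> quadrants\<close>, a
  subset of a Euclidean space, by the finite group \<open>N0\<close>, which acts freely by linear maps. The locale
  \<open>finite_smooth_quotient\<close> treats such quotients: the projection is open and locally injective, the
  quotient is Hausdorff and second countable, and a transition function of two charts that lift to
  charts upstairs is locally a composition of smooth maps, one of them the action of a group element.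
  The same argument shows that a smooth action upstairs descends if it is compatible with the projection. All
  charts in the atlas of \<open>\<X>'\<close> lift (\<open>\<X>'_chart_lifts\<close>). They cover \<open>\<X>'\<close> because the rotation group is
  covered by translates of the Cayley chart.

  Continuity into the Grassmannian holds since \<open>k \<cdot> W_Y\<close> is spanned by \<open>k \<cdot> X0\<close> and \<open>k \<cdot> Y\<close>, which depend
  continuously on \<open>k\<close> and on the normalized \<open>Y\<close>.
\<close>

section \<open>Calculus of smooth maps\<close>

text \<open>The predicate \<open>Ck_on\<close> speaks of \<open>frechet_derivative\<close>, a choice of derivative. On an open set the
  derivative is unique, so that any family of derivatives may be used instead; the introduction rule
  \<open>Ck_on_SucI\<close> is the form in which all closure properties are proved.\<close>

lemma Ck_on_cong:
  assumes "open S" "\<And>x. x \<in> S \<Longrightarrow> f x = g x" "Ck_on k S f"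
  shows "Ck_on k S g"
  using assms(2,3)
proof (induction k arbitrary: f g)
  case 0
  then show ?case by (simp cong: continuous_on_cong)
next
  case (Suc k)
  have der: "(g has_derivative frechet_derivative f (at x)) (at x)" if x: "x \<in> S" for x
  proof -
    have "f differentiable at x"
      using Suc.prems(2) x assms(1) by (auto simp: differentiable_on_eq_differentiable_at)
    then have "(f has_derivative frechet_derivative f (at x)) (at x)"
      by (simp add: frechet_derivative_works)
    then show ?thesis
      by (rule has_derivative_transform_within_open[OF _ assms(1) x Suc.prems(1)])
  qed
  have eq: "frechet_derivative f (at x) = frechet_derivative g (at x)" if "x \<in> S" for x
    using der[OF that] by (rule frechet_derivative_at)
  have "Ck_on k S (\<lambda>x. frechet_derivative g (at x) b)" if "b \<in> Basis" for b
    by (rule Suc.IH[where f = "\<lambda>x. frechet_derivative f (at x) b"])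
      (use Suc.prems(2) that eq in auto)
  moreover have "g differentiable_on S"
    using der assms(1) by (auto simp: differentiable_on_eq_differentiable_at differentiable_def)
  ultimately show ?case by simp
qed

lemma Ck_on_SucI:
  assumes "open S" "\<And>x. x \<in> S \<Longrightarrow> (f has_derivative f' x) (at x)"
    and "\<And>b. b \<in> Basis \<Longrightarrow> Ck_on k S (\<lambda>x. f' x b)"
  shows "Ck_on (Suc k) S f"
proof -
  have "f' x = frechet_derivative f (at x)" if "x \<in> S" for x
    using assms(2)[OF that] by (rule frechet_derivative_at)
  then have "Ck_on k S (\<lambda>x. frechet_derivative f (at x) b)" if "b \<in> Basis" for b
    by (intro Ck_on_cong[OF assms(1) _ assms(3)[OF that]]) simp
  moreover have "f differentiable_on S"
    using assms(1,2) by (auto simp: differentiable_on_eq_differentiable_at differentiable_def)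
  ultimately show ?thesis by simp
qed

lemma Ck_on_Suc_has_derivative:
  assumes "open S" "Ck_on (Suc k) S f" "x \<in> S"
  shows "(f has_derivative frechet_derivative f (at x)) (at x)"
  using assms by (auto simp: differentiable_on_eq_differentiable_at frechet_derivative_works)

lemma Ck_on_Suc_directional:
  "Ck_on (Suc k) S f \<Longrightarrow> b \<in> Basis \<Longrightarrow> Ck_on k S (\<lambda>x. frechet_derivative f (at x) b)"
  by simp

lemma Ck_on_imp_continuous_on: "Ck_on k S f \<Longrightarrow> continuous_on S f"
  by (cases k) (auto intro: differentiable_imp_continuous_on)

lemma Ck_on_open_subset:
  assumes "open S" "open T" "T \<subseteq> S" "Ck_on k S f"
  shows "Ck_on k T f"
  using assms(4)
proof (induction k arbitrary: f)
  case 0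
  then show ?case using assms(3) by (auto intro: continuous_on_subset)
next
  case (Suc k)
  then show ?case using assms(3) by (auto intro: differentiable_on_subset)
qed

lemma Ck_on_Suc_imp_Ck_on:
  assumes "open S" "Ck_on (Suc k) S f"
  shows "Ck_on k S f"
  using assms(2)
proof (induction k arbitrary: f)
  case 0
  then show ?case by (auto intro: differentiable_imp_continuous_on)
next
  case (Suc k)
  then show ?case by auto
qed

lemma Ck_on_bounded_linear_comp:
  assumes L: "bounded_linear L" and "open S" "Ck_on k S f"
  shows "Ck_on k S (\<lambda>x. L (f x))"
  using assms(3)
proof (induction k arbitrary: f)
  case 0
  then show ?case using bounded_linear.continuous_on[OF L] by simp
next
  case (Suc k)
  let ?f' = "\<lambda>x. frechet_derivative f (at x)"
  note f' = Ck_on_Suc_has_derivative[OF assms(2) Suc.prems] Ck_on_Suc_directional[OF Suc.prems]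
  show ?case
    by (rule Ck_on_SucI[OF assms(2), where f' = "\<lambda>x h. L (?f' x h)"])
      (auto intro: bounded_linear.has_derivative[OF L] f' Suc.IH)
qed

lemma Ck_on_const: "open S \<Longrightarrow> Ck_on k S (\<lambda>x. c)"
proof (induction k arbitrary: c)
  case (Suc k)
  show ?case by (rule Ck_on_SucI[where f' = "\<lambda>x h. 0"]) (use Suc in auto)
qed simp

lemma Ck_on_ident: "open S \<Longrightarrow> Ck_on k S (\<lambda>x. x)"
proof (cases k)
  case (Suc k)
  assume "open S"
  then show ?thesis unfolding Suc
    by (intro Ck_on_SucI[where f' = "\<lambda>x h. h"]) (auto intro: Ck_on_const)
qed simp

lemma Ck_on_add:
  assumes "open S" "Ck_on k S f" "Ck_on k S g"
  shows "Ck_on k S (\<lambda>x. f x + g x)"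
  using assms(2,3)
proof (induction k arbitrary: f g)
  case 0
  then show ?case by (simp add: continuous_on_add)
next
  case (Suc k)
  let ?f' = "\<lambda>x. frechet_derivative f (at x)"
  note f' = Ck_on_Suc_has_derivative[OF assms(1) Suc.prems(1)] Ck_on_Suc_directional[OF Suc.prems(1)]
  let ?g' = "\<lambda>x. frechet_derivative g (at x)"
  note g' = Ck_on_Suc_has_derivative[OF assms(1) Suc.prems(2)] Ck_on_Suc_directional[OF Suc.prems(2)]
  show ?case
    by (rule Ck_on_SucI[OF assms(1), where f' = "\<lambda>x h. ?f' x h + ?g' x h"])
      (use f' g' Suc.IH in \<open>auto intro: has_derivative_add\<close>)
qed

lemma Ck_on_sum:
  assumes "open S" "\<And>i. i \<in> I \<Longrightarrow> Ck_on k S (f i)"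
  shows "Ck_on k S (\<lambda>x. \<Sum>i\<in>I. f i x)"
  using assms(2)
  by (induction I rule: infinite_finite_induct) (auto intro: Ck_on_const Ck_on_add assms(1))

text \<open>The Leibniz rule: both summands of the derivative are again products, of factors with one
  derivative less in total.\<close>

lemma Ck_on_bilinear:
  assumes B: "bounded_bilinear B" and "open S" "Ck_on k S f" "Ck_on k S g"
  shows "Ck_on k S (\<lambda>x. B (f x) (g x))"
  using assms(3,4)
proof (induction k arbitrary: f g)
  case 0
  then show ?case using bounded_bilinear.continuous_on[OF B] by auto
next
  case (Suc k)
  let ?f' = "\<lambda>x. frechet_derivative f (at x)"
  note f' = Ck_on_Suc_has_derivative[OF assms(2) Suc.prems(1)] Ck_on_Suc_directional[OF Suc.prems(1)]
  let ?g' = "\<lambda>x. frechet_derivative g (at x)"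
  note g' = Ck_on_Suc_has_derivative[OF assms(2) Suc.prems(2)] Ck_on_Suc_directional[OF Suc.prems(2)]
  have "Ck_on k S f" "Ck_on k S g" using Suc.prems assms(2) by (auto intro: Ck_on_Suc_imp_Ck_on)
  then show ?case
    by (intro Ck_on_SucI[OF assms(2), where f' = "\<lambda>x h. B (f x) (?g' x h) + B (?f' x h) (g x)"]
        Ck_on_add assms(2) Suc.IH bounded_bilinear.FDERIV[OF B] f' g')
qed

lemma Ck_on_inverse:
  fixes f :: "'a::euclidean_space \<Rightarrow> real"
  assumes "open S" "\<And>x. x \<in> S \<Longrightarrow> f x \<noteq> 0" "Ck_on k S f"
  shows "Ck_on k S (\<lambda>x. inverse (f x))"
  using assms(3)
proof (induction k)
  case 0
  then show ?case using assms(2) by (simp add: continuous_on_inverse)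
next
  case (Suc k)
  let ?f' = "\<lambda>x. frechet_derivative f (at x)"
  note f' = Ck_on_Suc_has_derivative[OF assms(1) Suc.prems(1)] Ck_on_Suc_directional[OF Suc.prems(1)]
  have "Ck_on k S (\<lambda>x. inverse (f x))"
    using Suc assms(1) by (blast intro: Ck_on_Suc_imp_Ck_on)
  then have "Ck_on k S (\<lambda>x. - (inverse (f x) * ?f' x b * inverse (f x)))" if "b \<in> Basis" for b
    by (intro Ck_on_bounded_linear_comp[OF bounded_linear_minus[OF bounded_linear_ident] assms(1)]
        Ck_on_bilinear[OF bounded_bilinear_mult assms(1)] f'(2) that)
  then show ?case
    by (intro Ck_on_SucI[OF assms(1), where f' = "\<lambda>x h. - (inverse (f x) * ?f' x h * inverse (f x))"]
        Deriv.has_derivative_inverse assms(2) f') auto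
qed

text \<open>The derivative of \<open>g \<circ> f\<close> along \<open>b\<close> is expanded in the standard basis, so that only the partial
  derivatives of \<open>g\<close> occur, composed with \<open>f\<close>.\<close>

lemma Ck_on_compose:
  assumes "open S" "open T" "f ` S \<subseteq> T" "Ck_on k S f" "Ck_on k T g"
  shows "Ck_on k S (\<lambda>x. g (f x))"
  using assms(4,5)
proof (induction k arbitrary: g)
  case 0
  then show ?case using assms(3) by (auto intro: continuous_on_compose2)
next
  case (Suc k)
  let ?f' = "\<lambda>x. frechet_derivative f (at x)"
  note f' = Ck_on_Suc_has_derivative[OF assms(1) Suc.prems(1)] Ck_on_Suc_directional[OF Suc.prems(1)]
  let ?g' = "\<lambda>x. frechet_derivative g (at x)"
  note g' = Ck_on_Suc_has_derivative[OF assms(2) Suc.prems(2)] Ck_on_Suc_directional[OF Suc.prems(2)]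
  have fk: "Ck_on k S f" using Suc.prems assms(1) by (blast intro: Ck_on_Suc_imp_Ck_on)
  have expand: "(\<Sum>j\<in>Basis. (?f' x b \<bullet> j) *\<^sub>R ?g' (f x) j) = ?g' (f x) (?f' x b)" if "x \<in> S" for x b
  proof -
    have "linear (?g' (f x))" using g'(1)[of "f x"] that assms(3) has_derivative_linear by blast
    then have "?g' (f x) (\<Sum>j\<in>Basis. (?f' x b \<bullet> j) *\<^sub>R j) = (\<Sum>j\<in>Basis. (?f' x b \<bullet> j) *\<^sub>R ?g' (f x) j)"
      by (simp add: linear_sum linear_scale)
    then show ?thesis by (simp add: euclidean_representation)
  qed
  have "Ck_on k S (\<lambda>x. ?g' (f x) (?f' x b))" if "b \<in> Basis" for b
    by (rule Ck_on_cong[OF assms(1) expand])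
      (use fk f'(2) g'(2) that in \<open>auto intro!: Ck_on_sum Ck_on_bilinear[OF bounded_bilinear_scaleR]
         Ck_on_bounded_linear_comp[OF bounded_linear_inner_left] Suc.IH assms(1)\<close>)
  moreover have "((\<lambda>x. g (f x)) has_derivative (\<lambda>h. ?g' (f x) (?f' x h))) (at x)" if "x \<in> S" for x
    by (rule has_derivative_compose[OF f'(1)[OF that]]) (use g' that assms(3) in auto)
  ultimately show ?case by (intro Ck_on_SucI[OF assms(1)])
qed

lemma Ck_on_Pair:
  assumes "open S" "Ck_on k S f" "Ck_on k S g"
  shows "Ck_on k S (\<lambda>x. (f x, g x))"
proof -
  have "Ck_on k S (\<lambda>x. (f x, 0) + (0, g x))"
    by (intro Ck_on_add assms
        Ck_on_bounded_linear_comp[OF bounded_linear_Pair[OF bounded_linear_ident bounded_linear_zero]]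
        Ck_on_bounded_linear_comp[OF bounded_linear_Pair[OF bounded_linear_zero bounded_linear_ident]])
  then show ?thesis by simp
qed

lemma smooth_onI_ambient: "open U \<Longrightarrow> S \<subseteq> U \<Longrightarrow> (\<And>k. Ck_on k U f) \<Longrightarrow> smooth_on S f"
  unfolding smooth_on_def by blast

lemma smooth_onE:
  assumes "smooth_on S f" "x \<in> S"
  obtains U g where "open U" "x \<in> U" "\<And>k. Ck_on k U g" "\<And>y. y \<in> S \<Longrightarrow> y \<in> U \<Longrightarrow> g y = f y"
  using assms unfolding smooth_on_def by (metis IntI)

lemma smooth_onI:
  assumes "\<And>x. x \<in> S \<Longrightarrow>
    \<exists>U g. open U \<and> x \<in> U \<and> (\<forall>k. Ck_on k U g) \<and> (\<forall>y\<in>S \<inter> U. g y = f y)"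
  shows "smooth_on S f"
  using assms unfolding smooth_on_def by blast

lemma smooth_on_cong:
  assumes "smooth_on S f" "\<And>x. x \<in> S \<Longrightarrow> f x = g x"
  shows "smooth_on S g"
  using assms unfolding smooth_on_def by simp

lemma smooth_on_subset:
  assumes "smooth_on S f" "T \<subseteq> S"
  shows "smooth_on T f"
proof (rule smooth_onI)
  fix x assume "x \<in> T"
  then obtain U g where "open U" "x \<in> U" "\<And>k. Ck_on k U g"
    "\<And>y. y \<in> S \<Longrightarrow> y \<in> U \<Longrightarrow> g y = f y"
    using smooth_onE[OF assms(1)] assms(2) by (metis subsetD)
  then show "\<exists>U g. open U \<and> x \<in> U \<and> (\<forall>k. Ck_on k U g) \<and> (\<forall>y\<in>T \<inter> U. g y = f y)"
    using assms(2) by (intro exI[of _ U] exI[of _ g]) auto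
qed

lemma smooth_on_local:
  assumes "\<And>x. x \<in> S \<Longrightarrow> \<exists>U. open U \<and> x \<in> U \<and> smooth_on (S \<inter> U) f"
  shows "smooth_on S f"
proof (rule smooth_onI)
  fix x assume x: "x \<in> S"
  then obtain U where U: "open U" "x \<in> U" "smooth_on (S \<inter> U) f" using assms by blast
  then obtain V g where V: "open V" "x \<in> V" "\<And>k. Ck_on k V g" "\<And>y. y \<in> S \<inter> U \<inter> V \<Longrightarrow> g y = f y"
    using x unfolding smooth_on_def by (metis IntI)
  show "\<exists>U g. open U \<and> x \<in> U \<and> (\<forall>k. Ck_on k U g) \<and> (\<forall>y\<in>S \<inter> U. g y = f y)"
    by (rule exI[of _ "U \<inter> V"], rule exI[of _ g])
      (use U V Ck_on_open_subset[OF V(1) open_Int[OF U(1) V(1)] _ V(3)] in auto)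
qed

lemma smooth_on_imp_continuous_on:
  assumes "smooth_on S f" shows "continuous_on S f"
  unfolding continuous_on_eq_continuous_within
proof
  fix x assume x: "x \<in> S"
  then obtain U g where U: "open U" "x \<in> U" "\<And>k. Ck_on k U g" "\<And>y. y \<in> S \<inter> U \<Longrightarrow> g y = f y"
    using assms unfolding smooth_on_def by metis
  have "continuous (at x within S) g"
    using Ck_on_imp_continuous_on[OF U(3)] U(1,2)
    by (simp add: continuous_on_eq_continuous_at continuous_at_imp_continuous_at_within)
  then have "continuous (at x within S \<inter> U) g" by (rule continuous_within_subset) auto
  then have "continuous (at x within S \<inter> U) f"
    by (rule continuous_transform_within[OF _ zero_less_one]) (use U x in auto)
  then show "continuous (at x within S) f"
    using at_within_nhd[OF U(2,1), of S "S \<inter> U"] by (simp add: continuous_within Int_assoc)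
qed

lemma smooth_on_compose:
  assumes "smooth_on S f" "smooth_on T g" "f ` S \<subseteq> T"
  shows "smooth_on S (\<lambda>x. g (f x))"
  unfolding smooth_on_def
proof
  fix x assume x: "x \<in> S"
  obtain U f' where U: "open U" "x \<in> U" "\<And>k. Ck_on k U f'" "\<And>y. y \<in> S \<inter> U \<Longrightarrow> f' y = f y"
    using assms(1) x unfolding smooth_on_def by metis
  obtain V g' where V: "open V" "f x \<in> V" "\<And>k. Ck_on k V g'" "\<And>y. y \<in> T \<inter> V \<Longrightarrow> g' y = g y"
    using assms(2,3) x unfolding smooth_on_def by (metis image_subset_iff)
  let ?W = "U \<inter> f' -` V"
  have W: "open ?W"
    using Ck_on_imp_continuous_on[OF U(3)] U(1) V(1) by (auto simp: continuous_on_open_vimage Int_commute)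
  have "Ck_on k ?W (\<lambda>x. g' (f' x))" for k
    by (rule Ck_on_compose[OF W V(1) _ Ck_on_open_subset[OF U(1) W _ U(3)] V(3)]) auto
  then show "\<exists>U h. open U \<and> x \<in> U \<and> (\<forall>k. Ck_on k U h) \<and> (\<forall>y\<in>S \<inter> U. h y = g (f y))"
    by (intro exI[of _ ?W] exI[of _ "\<lambda>x. g' (f' x)"]) (use W U V x assms(3) in auto)
qed

lemma smooth_on_Pair:
  assumes "smooth_on S f" "smooth_on S g"
  shows "smooth_on S (\<lambda>x. (f x, g x))"
  unfolding smooth_on_def
proof
  fix x assume x: "x \<in> S"
  obtain U f' where U: "open U" "x \<in> U" "\<And>k. Ck_on k U f'" "\<And>y. y \<in> S \<inter> U \<Longrightarrow> f' y = f y"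
    using assms(1) x unfolding smooth_on_def by metis
  obtain V g' where V: "open V" "x \<in> V" "\<And>k. Ck_on k V g'" "\<And>y. y \<in> S \<inter> V \<Longrightarrow> g' y = g y"
    using assms(2) x unfolding smooth_on_def by metis
  have W: "open (U \<inter> V)" using U(1) V(1) by blast
  have "Ck_on k (U \<inter> V) (\<lambda>x. (f' x, g' x))" for k
    by (intro Ck_on_Pair W Ck_on_open_subset[OF U(1) W _ U(3)] Ck_on_open_subset[OF V(1) W _ V(3)])
      auto
  then show "\<exists>U h. open U \<and> x \<in> U \<and> (\<forall>k. Ck_on k U h) \<and> (\<forall>y\<in>S \<inter> U. h y = (f y, g y))"
    by (intro exI[of _ "U \<inter> V"] exI[of _ "\<lambda>x. (f' x, g' x)"]) (use W U V x in auto)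
qed

lemma smooth_on_bounded_linear: "bounded_linear L \<Longrightarrow> smooth_on S L"
  by (rule smooth_onI_ambient[OF open_UNIV subset_UNIV])
    (rule Ck_on_bounded_linear_comp[OF _ open_UNIV Ck_on_ident[OF open_UNIV]])

lemma smooth_on_bilinear:
  assumes "bounded_bilinear B" "smooth_on S f" "smooth_on S g"
  shows "smooth_on S (\<lambda>x. B (f x) (g x))"
proof -
  have "smooth_on UNIV (\<lambda>(x, y). B x y)"
    unfolding split_beta
    by (rule smooth_onI_ambient[OF open_UNIV])
      (auto intro!: Ck_on_bilinear[OF assms(1)] Ck_on_bounded_linear_comp[OF bounded_linear_fst]
        Ck_on_bounded_linear_comp[OF bounded_linear_snd] Ck_on_ident)
  from smooth_on_compose[OF smooth_on_Pair[OF assms(2,3)] this] show ?thesis by simp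
qed

lemma smooth_on_const: "smooth_on S (\<lambda>x. c)"
  by (rule smooth_onI_ambient[OF open_UNIV]) (auto intro: Ck_on_const)

lemma smooth_on_ident: "smooth_on S (\<lambda>x. x)"
  by (rule smooth_on_bounded_linear[OF bounded_linear_ident])

lemma smooth_on_linear_comp:
  assumes "bounded_linear L" "smooth_on S f" shows "smooth_on S (\<lambda>x. L (f x))"
  by (rule smooth_on_compose[OF assms(2) smooth_on_bounded_linear[OF assms(1)], of UNIV]) simp

lemma smooth_on_fst: "smooth_on S f \<Longrightarrow> smooth_on S (\<lambda>x. fst (f x))"
  by (rule smooth_on_linear_comp[OF bounded_linear_fst])

lemma smooth_on_snd: "smooth_on S f \<Longrightarrow> smooth_on S (\<lambda>x. snd (f x))"
  by (rule smooth_on_linear_comp[OF bounded_linear_snd])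

lemma smooth_on_add:
  assumes "smooth_on S f" "smooth_on S g"
  shows "smooth_on S (\<lambda>x. f x + g x)"
  using smooth_on_linear_comp[OF bounded_linear_add[OF bounded_linear_fst bounded_linear_snd]
      smooth_on_Pair[OF assms]] by simp

lemma smooth_on_inverse:
  fixes f :: "'a::euclidean_space \<Rightarrow> real"
  assumes "smooth_on S f" "\<And>x. x \<in> S \<Longrightarrow> f x \<noteq> 0"
  shows "smooth_on S (\<lambda>x. inverse (f x))"
proof (rule smooth_on_compose[OF assms(1), where T = "- {0}"])
  have o: "open (- {0 :: real})" by (rule open_Compl[OF closed_singleton])
  show "smooth_on (- {0}) (inverse :: real \<Rightarrow> real)"
    by (rule smooth_onI_ambient[OF o subset_refl], rule Ck_on_inverse[OF o _ Ck_on_ident[OF o]]) blast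
qed (use assms(2) in auto)

lemma bounded_bilinear_matrix_mult:
  "bounded_bilinear ((**) :: real^'n^'m \<Rightarrow> real^'p^'n \<Rightarrow> real^'p^'m)"
  unfolding bilinear_conv_bounded_bilinear[symmetric] bilinear_def
  by (intro conjI allI linearI; simp add: vec_eq_iff matrix_matrix_mult_def distrib_right
      distrib_left sum.distrib sum_distrib_left; simp add: mult_ac)

lemma smooth_on_matrix_mult:
  fixes f :: "'a::euclidean_space \<Rightarrow> real^'n^'m" and g :: "'a \<Rightarrow> real^'p^'n"
  shows "smooth_on S f \<Longrightarrow> smooth_on S g \<Longrightarrow> smooth_on S (\<lambda>x. f x ** g x)"
  by (rule smooth_on_bilinear[OF bounded_bilinear_matrix_mult])

lemmas smooth_on_mult = smooth_on_bilinear[OF bounded_bilinear_mult]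
lemmas smooth_on_scaleR = smooth_on_bilinear[OF bounded_bilinear_scaleR]

lemmas smooth_on_intros =
  smooth_on_const smooth_on_ident smooth_on_fst smooth_on_snd smooth_on_Pair smooth_on_add
  smooth_on_mult smooth_on_scaleR smooth_on_matrix_mult smooth_on_inverse

section \<open>Charts of submanifolds\<close>

lemma submanifold_atlasE:
  assumes "(U, \<phi>) \<in> submanifold_atlas S"
  obtains "openin (top_of_set S) U" "U \<subseteq> S" "open (\<phi> ` U)" "inj_on \<phi> U" "smooth_on U \<phi>"
    "smooth_on (\<phi> ` U) (inv_into U \<phi>)"
  using assms openin_imp_subset unfolding submanifold_atlas_def by blast

text \<open>A chart and its inverse are smooth, hence continuous.\<close>

lemma submanifold_chart_homeomorphic_map:
  assumes "(U, \<phi>) \<in> submanifold_atlas S"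
  shows "homeomorphic_map (top_of_set U) (top_of_set (\<phi> ` U)) \<phi>"
proof -
  obtain c: "inj_on \<phi> U" "smooth_on U \<phi>" "smooth_on (\<phi> ` U) (inv_into U \<phi>)"
    using assms by (rule submanifold_atlasE)
  have "homeomorphic_maps (top_of_set U) (top_of_set (\<phi> ` U)) \<phi> (inv_into U \<phi>)"
    unfolding homeomorphic_maps_def
    using c(1) smooth_on_imp_continuous_on[OF c(2)] smooth_on_imp_continuous_on[OF c(3)]
    by (auto simp: continuous_map_in_subtopology inv_into_into f_inv_into_f)
  then show ?thesis by (rule homeomorphic_maps_imp_map)
qed

lemma submanifold_chart_open_image:
  assumes "(U, \<phi>) \<in> submanifold_atlas S" "openin (top_of_set S) V" "V \<subseteq> U"
  shows "open (\<phi> ` V)"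
proof -
  have "openin (top_of_set U) V"
    using assms submanifold_atlasE by (metis openin_subset_trans)
  then have "openin (top_of_set (\<phi> ` U)) (\<phi> ` V)"
    using homeomorphic_map_openness[OF submanifold_chart_homeomorphic_map[OF assms(1)], of V] assms(3)
    by simp
  then show ?thesis
    using assms(1) submanifold_atlasE by (metis openin_open_trans)
qed

lemma submanifold_atlas_restrict:
  assumes "(U, \<phi>) \<in> submanifold_atlas S" "openin (top_of_set S) V" "V \<subseteq> U"
  shows "(V, \<phi>) \<in> submanifold_atlas S"
proof -
  obtain U: "inj_on \<phi> U" "smooth_on U \<phi>" "smooth_on (\<phi> ` U) (inv_into U \<phi>)"
    using assms(1) by (rule submanifold_atlasE)
  have inj: "inj_on \<phi> V" using U(1) assms(3) by (rule inj_on_subset)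
  have "smooth_on (\<phi> ` V) (inv_into U \<phi>)"
    using U(3) by (rule smooth_on_subset) (use assms(3) in blast)
  then have "smooth_on (\<phi> ` V) (inv_into V \<phi>)"
    by (rule smooth_on_cong) (use inj U(1) assms(3) in \<open>auto simp: inv_into_f_f subset_iff\<close>)
  then show ?thesis
    using submanifold_chart_open_image[OF assms] inj smooth_on_subset[OF U(2) assms(3)] assms(2)
    unfolding submanifold_atlas_def by blast
qed

lemma submanifold_atlas_Times:
  assumes "(U, \<phi>) \<in> submanifold_atlas S" "(V, \<psi>) \<in> submanifold_atlas T"
  shows "(U \<times> V, map_prod \<phi> \<psi>) \<in> submanifold_atlas (S \<times> T)"
proof -
  obtain U: "openin (top_of_set S) U" "open (\<phi> ` U)" "inj_on \<phi> U" "smooth_on U \<phi>"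
    "smooth_on (\<phi> ` U) (inv_into U \<phi>)"
    using assms(1) by (rule submanifold_atlasE)
  obtain V: "openin (top_of_set T) V" "open (\<psi> ` V)" "inj_on \<psi> V" "smooth_on V \<psi>"
    "smooth_on (\<psi> ` V) (inv_into V \<psi>)"
    using assms(2) by (rule submanifold_atlasE)
  have img: "map_prod \<phi> \<psi> ` (U \<times> V) = \<phi> ` U \<times> \<psi> ` V" by (rule map_prod_surj_on) auto
  have inj: "inj_on (map_prod \<phi> \<psi>) (U \<times> V)" using U(3) V(3) by (rule map_prod_inj_on)
  have "smooth_on (U \<times> V) (\<lambda>x. (\<phi> (fst x), \<psi> (snd x)))"
    by (intro smooth_on_Pair smooth_on_compose[OF smooth_on_fst[OF smooth_on_ident] U(4)]
        smooth_on_compose[OF smooth_on_snd[OF smooth_on_ident] V(4)]) auto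
  then have s1: "smooth_on (U \<times> V) (map_prod \<phi> \<psi>)" by (rule smooth_on_cong) auto
  have "smooth_on (\<phi> ` U \<times> \<psi> ` V) (\<lambda>x. (inv_into U \<phi> (fst x), inv_into V \<psi> (snd x)))"
    by (intro smooth_on_Pair smooth_on_compose[OF smooth_on_fst[OF smooth_on_ident] U(5)]
        smooth_on_compose[OF smooth_on_snd[OF smooth_on_ident] V(5)]) auto
  then have "smooth_on (\<phi> ` U \<times> \<psi> ` V) (inv_into (U \<times> V) (map_prod \<phi> \<psi>))"
  proof (rule smooth_on_cong)
    fix x assume "x \<in> \<phi> ` U \<times> \<psi> ` V"
    then obtain u v where uv: "u \<in> U" "v \<in> V" "x = map_prod \<phi> \<psi> (u, v)" by auto
    then have "inv_into (U \<times> V) (map_prod \<phi> \<psi>) x = (u, v)"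
      using inv_into_f_f[OF inj, of "(u, v)"] by simp
    then show "(inv_into U \<phi> (fst x), inv_into V \<psi> (snd x)) = inv_into (U \<times> V) (map_prod \<phi> \<psi>) x"
      using uv U(3) V(3) by simp
  qed
  then show ?thesis
    unfolding submanifold_atlas_def
    using U(1,2) V(1,2) inj s1 by (simp add: img openin_Times open_Times)
qed

section \<open>Quotients by finitely many diffeomorphisms\<close>

lemma openin_quotient_topology_image:
  assumes "U \<subseteq> topspace T" "openin T {x \<in> topspace T. f x \<in> f ` U}"
  shows "openin (quotient_topology T f) (f ` U)"
  using assms by (auto simp: openin_quotient_topology)

lemma continuous_map_quotient_topology: "continuous_map T (quotient_topology T f) f"
  by (auto simp: continuous_map_def topspace_quotient_topology openin_quotient_topology)

lemma continuous_map_from_quotient_topology: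
  assumes "continuous_map T S (\<lambda>x. h (f x))"
  shows "continuous_map (quotient_topology T f) S h"
  unfolding continuous_map_def
proof (intro conjI allI impI)
  show "h \<in> topspace (quotient_topology T f) \<rightarrow> topspace S"
    using assms by (auto simp: continuous_map_def topspace_quotient_topology)
  fix V assume "openin S V"
  then have "openin T {x \<in> topspace T. h (f x) \<in> V}"
    using assms by (simp add: continuous_map_def)
  moreover have "{x \<in> topspace T. f x \<in> {y \<in> f ` topspace T. h y \<in> V}} =
      {x \<in> topspace T. h (f x) \<in> V}" by blast
  ultimately show "openin (quotient_topology T f) {y \<in> topspace (quotient_topology T f). h y \<in> V}"
    unfolding openin_quotient_topology topspace_quotient_topology by auto
qed

lemma quotient_topology_comp:
  "quotient_topology (quotient_topology T f) g = quotient_topology T (g \<circ> f)"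
proof -
  have "openin (quotient_topology (quotient_topology T f) g) V \<longleftrightarrow>
      openin (quotient_topology T (g \<circ> f)) V" for V
  proof -
    have "{x \<in> topspace T. f x \<in> {y \<in> f ` topspace T. g y \<in> V}} = {x \<in> topspace T. (g \<circ> f) x \<in> V}"
      by auto
    then show ?thesis
      unfolding openin_quotient_topology topspace_quotient_topology by (auto simp: image_comp)
  qed
  then show ?thesis by (simp add: topology_eq)
qed

text \<open>A quotient topology may be computed after replacing the source by a homeomorphic space. In this
  way spaces of lines are replaced by subsets of Euclidean spaces.\<close>

lemma quotient_topology_homeomorphic_map:
  assumes h: "homeomorphic_map S T h"
  shows "quotient_topology T f = quotient_topology S (f \<circ> h)"
proof -
  have im: "h ` topspace S = topspace T"
    using h by (rule homeomorphic_imp_surjective_map)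
  have "openin T {y \<in> topspace T. f y \<in> V} \<longleftrightarrow> openin S {x \<in> topspace S. f (h x) \<in> V}" for V
  proof -
    have "h ` {x \<in> topspace S. f (h x) \<in> V} = {y \<in> topspace T. f y \<in> V}"
      by (auto simp flip: im)
    then show ?thesis
      using homeomorphic_map_openness[OF h, of "{x \<in> topspace S. f (h x) \<in> V}"] by simp
  qed
  then show ?thesis
    unfolding topology_eq openin_quotient_topology using im[symmetric] by (simp add: image_comp)
qed

text \<open>The quotient of a subset \<open>P\<close> of Euclidean space by a free action of a finite group, presented by its
  projection \<open>Q\<close>. In place of the group axioms there is the assumption that the fibres of \<open>Q\<close> are the
  orbits of the family \<open>g\<close>; this is the form in which orbits are used. Freeness reads: a \<open>g i\<close> with a fixed point is
  the identity.\<close>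

locale finite_smooth_quotient =
  fixes P :: "'a::euclidean_space set" and I :: "'i set" and g :: "'i \<Rightarrow> 'a \<Rightarrow> 'a"
    and Q :: "'a \<Rightarrow> 'x"
  assumes finite_I: "finite I"
    and smooth_g: "i \<in> I \<Longrightarrow> smooth_on P (g i)"
    and g_in: "i \<in> I \<Longrightarrow> u \<in> P \<Longrightarrow> g i u \<in> P"
    and fibre: "u \<in> P \<Longrightarrow> v \<in> P \<Longrightarrow> Q u = Q v \<longleftrightarrow> (\<exists>i\<in>I. v = g i u)"
    and free: "i \<in> I \<Longrightarrow> u \<in> P \<Longrightarrow> g i u = u \<Longrightarrow> v \<in> P \<Longrightarrow> g i v = v"
begin

abbreviation T :: "'x topology" where "T \<equiv> quotient_topology (top_of_set P) Q"

lemma Q_g: "i \<in> I \<Longrightarrow> u \<in> P \<Longrightarrow> Q (g i u) = Q u"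
  using fibre g_in by metis

lemma openin_T: "openin T V \<longleftrightarrow> V \<subseteq> Q ` P \<and> openin (top_of_set P) {u \<in> P. Q u \<in> V}"
  by (simp add: openin_quotient_topology)

lemma topspace_T: "topspace T = Q ` P"
  by (simp add: topspace_quotient_topology)

lemma openin_vimage_g:
  assumes "i \<in> I" "openin (top_of_set P) U"
  shows "openin (top_of_set P) {u \<in> P. g i u \<in> U}"
proof -
  have "continuous_map (top_of_set P) (top_of_set P) (g i)"
    using smooth_on_imp_continuous_on[OF smooth_g[OF assms(1)]] g_in[OF assms(1)]
    by (auto simp: continuous_map_in_subtopology)
  from openin_continuous_map_preimage[OF this assms(2)] show ?thesis by simp
qed

text \<open>The saturation of an open set is the union of its preimages under the \<open>g i\<close>.\<close>

lemma openin_T_image: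
  assumes "openin (top_of_set P) U"
  shows "openin T (Q ` U)"
proof -
  have sub: "U \<subseteq> P" using assms by (rule openin_imp_subset)
  have "{v \<in> P. Q v \<in> Q ` U} = (\<Union>i\<in>I. {v \<in> P. g i v \<in> U})"
  proof (intro equalityI subsetI)
    fix v assume "v \<in> {v \<in> P. Q v \<in> Q ` U}"
    then obtain u where "v \<in> P" "u \<in> U" "Q v = Q u" by blast
    then show "v \<in> (\<Union>i\<in>I. {v \<in> P. g i v \<in> U})" using fibre[of v u] sub by blast
  next
    fix v assume "v \<in> (\<Union>i\<in>I. {v \<in> P. g i v \<in> U})"
    then obtain i where "i \<in> I" "v \<in> P" "g i v \<in> U" by blast
    then show "v \<in> {v \<in> P. Q v \<in> Q ` U}" using Q_g[of i v] by (metis (mono_tags, lifting) imageI mem_Collect_eq)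
  qed
  moreover have "openin (top_of_set P) (\<Union>i\<in>I. {v \<in> P. g i v \<in> U})"
    using openin_vimage_g[OF _ assms] by blast
  ultimately show ?thesis using sub by (intro openin_quotient_topology_image) auto
qed

lemma open_map_Q: "open_map (top_of_set P) T Q"
  using openin_T_image by (simp add: open_map_def)

lemma second_countable_T: "second_countable T"
proof (rule second_countable_open_map_image[OF continuous_map_quotient_topology open_map_Q])
  obtain B :: "'a set set" where B: "countable B" "\<And>C. C \<in> B \<Longrightarrow> open C"
    "\<And>S. open S \<Longrightarrow> \<exists>U. U \<subseteq> B \<and> S = \<Union> U"
    using univ_second_countable by blast
  have "\<exists>V\<in>B. x \<in> V \<and> V \<subseteq> U" if "open U" "x \<in> U" for U x
    using B(3)[OF that(1)] that(2) by blast
  then have "second_countable (euclidean :: 'a topology)"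
    unfolding second_countable_def using B(1,2) by (intro exI[of _ B]) auto
  then show "second_countable (top_of_set P)" by (rule second_countable_subtopology)
qed (simp add: topspace_T)

text \<open>For points \<open>u\<close> and \<open>v\<close> in different fibres, each \<open>g i u\<close> is separated from \<open>v\<close>; finitely many
  neighbourhoods of \<open>u\<close> and of \<open>v\<close> are intersected.\<close>

lemma Hausdorff_T: "Hausdorff_space T"
  unfolding Hausdorff_space_def topspace_T
proof (intro allI impI, elim conjE)
  fix x y assume "x \<in> Q ` P" "y \<in> Q ` P" "x \<noteq> y"
  then obtain u v where uv: "u \<in> P" "x = Q u" "v \<in> P" "y = Q v" "Q u \<noteq> Q v" by blast
  have "\<exists>A B. open A \<and> open B \<and> g i u \<in> A \<and> v \<in> B \<and> A \<inter> B = {}" if "i \<in> I" for i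
    using uv that fibre[of u v] by (intro hausdorff) blast
  then obtain A B where AB: "\<And>i. i \<in> I \<Longrightarrow> open (A i)" "\<And>i. i \<in> I \<Longrightarrow> open (B i)"
    "\<And>i. i \<in> I \<Longrightarrow> g i u \<in> A i" "\<And>i. i \<in> I \<Longrightarrow> v \<in> B i" "\<And>i. i \<in> I \<Longrightarrow> A i \<inter> B i = {}"
    by metis
  define U where "U = (\<Inter>i\<in>I. {w \<in> P. g i w \<in> P \<inter> A i}) \<inter> P"
  define V where "V = (\<Inter>i\<in>I. P \<inter> B i) \<inter> P"
  have "openin (top_of_set P) U"
    unfolding U_def
    using openin_INT[OF finite_I openin_vimage_g[OF _ openin_open_Int[OF AB(1)]], of "\<lambda>i. i" "\<lambda>i. i"]
    by simp
  moreover have "openin (top_of_set P) V"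
    unfolding V_def using openin_INT[OF finite_I openin_open_Int[OF AB(2)], of "\<lambda>i. i" P] by simp
  moreover have "disjnt (Q ` U) (Q ` V)"
  proof -
    have "Q a \<noteq> Q b" if "a \<in> U" "b \<in> V" for a b
    proof
      assume "Q a = Q b"
      moreover have "a \<in> P" "b \<in> P" using that by (auto simp: U_def V_def)
      ultimately obtain i where "i \<in> I" "b = g i a" using fibre[of a b] by blast
      moreover from this have "g i a \<in> A i" "b \<in> B i" using that unfolding U_def V_def by blast+
      ultimately show False using AB(5)[of i] by blast
    qed
    then show ?thesis by (auto simp: disjnt_def)
  qed
  moreover have "u \<in> U" "v \<in> V" using uv AB(3,4) g_in by (auto simp: U_def V_def)
  ultimately show "\<exists>U V. openin T U \<and> openin T V \<and> x \<in> U \<and> y \<in> V \<and> disjnt U V"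
    using openin_T_image uv by blast
qed

text \<open>Around \<open>u\<close>, separate \<open>u\<close> from all its images under those \<open>g i\<close> that do not fix it; the
  others are the identity by freeness.\<close>

lemma locally_injective:
  assumes u: "u \<in> P"
  obtains N where "openin (top_of_set P) N" "u \<in> N" "inj_on Q N"
proof -
  define J where "J = {i \<in> I. g i u \<noteq> u}"
  have "\<exists>A B. open A \<and> open B \<and> g i u \<in> A \<and> u \<in> B \<and> A \<inter> B = {}" if "i \<in> J" for i
    using that by (intro hausdorff) (simp add: J_def)
  then obtain A B where AB: "\<And>i. i \<in> J \<Longrightarrow> open (A i)" "\<And>i. i \<in> J \<Longrightarrow> open (B i)"
    "\<And>i. i \<in> J \<Longrightarrow> g i u \<in> A i" "\<And>i. i \<in> J \<Longrightarrow> u \<in> B i" "\<And>i. i \<in> J \<Longrightarrow> A i \<inter> B i = {}"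
    by metis
  define N where "N = (\<Inter>i\<in>J. {w \<in> P. g i w \<in> P \<inter> A i} \<inter> (P \<inter> B i)) \<inter> P"
  have J: "finite J" "\<And>i. i \<in> J \<Longrightarrow> i \<in> I" using finite_I by (auto simp: J_def)
  have "openin (top_of_set P) N"
  proof -
    have "openin (top_of_set P) ({w \<in> P. g i w \<in> P \<inter> A i} \<inter> (P \<inter> B i))" if "i \<in> J" for i
      using that J(2) AB(1,2) by (intro openin_Int openin_vimage_g openin_open_Int)
    from openin_INT[OF J(1) this] show ?thesis by (simp add: N_def)
  qed
  moreover have "u \<in> N" using u AB(3,4) g_in J by (auto simp: N_def)
  moreover have "inj_on Q N"
  proof (rule inj_onI)
    fix a b assume ab: "a \<in> N" "b \<in> N" "Q a = Q b"
    then obtain i where i: "i \<in> I" "b = g i a" using fibre[of a b] by (auto simp: N_def)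
    show "a = b"
    proof (cases "i \<in> J")
      case True
      then show ?thesis using i ab AB(5)[of i] by (auto simp: N_def)
    next
      case False
      then show ?thesis using i free[OF i(1) u, of a] ab(1) by (auto simp: J_def N_def)
    qed
  qed
  ultimately show thesis by (rule that)
qed

text \<open>A chart of the quotient that is, in disguise, a chart of \<open>P\<close> on a domain mapped injectively
  to the quotient. Everything about smoothness is checked for such charts, and they are compared on
  points of \<open>P\<close> only, because the chart maps of pushed forward atlases contain nested local inverses.\<close>

definition lifts_to :: "('x, 'e::euclidean_space) chart \<Rightarrow> ('a, 'e) chart \<Rightarrow> bool" where
  "lifts_to = (\<lambda>(V, \<xi>) (U, c). (U, c) \<in> submanifold_atlas P \<and> inj_on Q U \<and> V = Q ` U \<and>
     (\<forall>u\<in>U. \<xi> (Q u) = c u))"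

lemma lifted_chart_homeomorphic_map:
  assumes "lifts_to (V, \<xi>) (U, c)"
  shows "openin T V" "\<xi> ` V = c ` U" "inj_on \<xi> V"
    "homeomorphic_map (subtopology T V) (top_of_set (\<xi> ` V)) \<xi>"
proof -
  have l: "(U, c) \<in> submanifold_atlas P" "inj_on Q U" "V = Q ` U" "\<And>u. u \<in> U \<Longrightarrow> \<xi> (Q u) = c u"
    using assms by (auto simp: lifts_to_def)
  obtain U: "openin (top_of_set P) U" "U \<subseteq> P" "inj_on c U"
    using l(1) by (rule submanifold_atlasE)
  show o: "openin T V" using openin_T_image[OF U(1)] l(3) by simp
  show im: "\<xi> ` V = c ` U" using l(3,4) by (auto simp: image_iff)
  show "inj_on \<xi> V"
  proof (rule inj_onI)
    fix x y assume xy: "x \<in> V" "y \<in> V" "\<xi> x = \<xi> y"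
    then obtain u v where "x = Q u" "y = Q v" "u \<in> U" "v \<in> U" using l(3) by blast
    then show "x = y" using xy l(4) inj_onD[OF U(3)] by metis
  qed
  have "homeomorphic_map (top_of_set U) (subtopology T V) Q"
  proof (rule bijective_open_imp_homeomorphic_map)
    show "continuous_map (top_of_set U) (subtopology T V) Q"
      using continuous_map_from_subtopology[OF continuous_map_quotient_topology,
          where S = U and X = "top_of_set P"] U(2) l(3)
      by (auto simp: continuous_map_in_subtopology subtopology_subtopology Int_absorb1)
    show "open_map (top_of_set U) (subtopology T V) Q"
      unfolding open_map_def
    proof (intro allI impI)
      fix W assume W: "openin (top_of_set U) W"
      then have "openin (top_of_set P) W" using U(1) openin_trans by blast
      then have "openin T (Q ` W)" by (rule openin_T_image)
      then show "openin (subtopology T V) (Q ` W)"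
        using openin_open_subtopology[OF o] openin_imp_subset[OF W] l(3) by (simp add: image_mono)
    qed
    show "Q ` topspace (top_of_set U) = topspace (subtopology T V)"
      using o l(3) openin_subset by (auto simp: topspace_subtopology)
  qed (use l(2) in simp)
  then obtain q where q: "homeomorphic_maps (top_of_set U) (subtopology T V) Q q"
    unfolding homeomorphic_map_maps by blast
  then have "homeomorphic_map (subtopology T V) (top_of_set U) q"
    using homeomorphic_maps_sym homeomorphic_maps_imp_map by blast
  from homeomorphic_map_compose[OF this submanifold_chart_homeomorphic_map[OF l(1)]]
  have "homeomorphic_map (subtopology T V) (top_of_set (\<xi> ` V)) (c \<circ> q)" by (simp add: im)
  then show "homeomorphic_map (subtopology T V) (top_of_set (\<xi> ` V)) \<xi>"
  proof (rule homeomorphic_map_eq)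
    fix x assume "x \<in> topspace (subtopology T V)"
    then obtain u where u: "u \<in> U" "x = Q u" using l(3) by auto
    then have "q x = u" using q by (simp add: homeomorphic_maps_def)
    then show "(c \<circ> q) x = \<xi> x" using u l(4) by simp
  qed
qed

text \<open>Smoothness into the quotient may be tested upstairs: whenever \<open>h\<close> takes values in \<open>P\<close>, near a
  given point some fixed \<open>g i\<close> moves \<open>h\<close> into the domain \<open>U\<close> of the lifted chart, and there the
  coordinate expression is that of \<open>g i \<circ> h\<close>.\<close>

lemma smooth_on_lifted_chart:
  assumes lift: "lifts_to (V, \<xi>) (U, c)"
    and b: "(B, b) \<in> submanifold_atlas R" and h: "smooth_on R h" "h ` R \<subseteq> P"
  shows "smooth_on (b ` {r \<in> B. Q (h r) \<in> V}) (\<lambda>z. \<xi> (Q (h (inv_into B b z))))"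
proof (rule smooth_on_local)
  have l: "(U, c) \<in> submanifold_atlas P" "inj_on Q U" "V = Q ` U" "\<And>u. u \<in> U \<Longrightarrow> \<xi> (Q u) = c u"
    using lift by (auto simp: lifts_to_def)
  obtain U: "openin (top_of_set P) U" "U \<subseteq> P" "smooth_on U c"
    using l(1) by (rule submanifold_atlasE)
  obtain B: "openin (top_of_set R) B" "B \<subseteq> R" "inj_on b B" "smooth_on (b ` B) (inv_into B b)"
    using b by (rule submanifold_atlasE)
  fix y assume "y \<in> b ` {r \<in> B. Q (h r) \<in> V}"
  then obtain r where r: "y = b r" "r \<in> B" "Q (h r) \<in> V" by blast
  then obtain u where u: "u \<in> U" "Q (h r) = Q u" using l(3) by blast
  then obtain i where i: "i \<in> I" "g i (h r) \<in> U"
    using fibre[of "h r" u] r(2) B(2) U(2) h(2) by blast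
  define N where "N = B \<inter> {r \<in> R. h r \<in> {v \<in> P. g i v \<in> U}}"
  have "openin (top_of_set R) {r \<in> R. h r \<in> {v \<in> P. g i v \<in> U}}"
  proof -
    have "continuous_map (top_of_set R) (top_of_set P) h"
      using smooth_on_imp_continuous_on[OF h(1)] h(2) by (auto simp: continuous_map_in_subtopology)
    from openin_continuous_map_preimage[OF this openin_vimage_g[OF i(1) U(1)]] show ?thesis by simp
  qed
  then have N: "openin (top_of_set R) N" "N \<subseteq> B" using B(1) by (auto simp: N_def)
  have sm: "smooth_on (b ` N) (\<lambda>z. c (g i (h (inv_into B b z))))"
  proof (rule smooth_on_compose[OF _ U(3)], rule smooth_on_compose[OF _ smooth_g[OF i(1)]],
      rule smooth_on_compose[OF _ h(1)])
    show "smooth_on (b ` N) (inv_into B b)"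
      using B(4) by (rule smooth_on_subset) (use N(2) in blast)
  qed (use B(2,3) N(2) h(2) in \<open>auto simp: N_def\<close>)
  have "smooth_on (b ` N) (\<lambda>z. \<xi> (Q (h (inv_into B b z))))"
  proof (rule smooth_on_cong[OF sm])
    fix z assume "z \<in> b ` N"
    then obtain r' where "r' \<in> N" "z = b r'" by blast
    then show "c (g i (h (inv_into B b z))) = \<xi> (Q (h (inv_into B b z)))"
      using B(3) l(4) Q_g[OF i(1)] by (auto simp: N_def) metis
  qed
  moreover have "b ` {r \<in> B. Q (h r) \<in> V} \<inter> b ` N \<subseteq> b ` N" by blast
  moreover have "open (b ` N)" by (rule submanifold_chart_open_image[OF b N])
  moreover have "y \<in> b ` N" using r i B(2) h(2) by (auto simp: N_def)
  ultimately show "\<exists>W. open W \<and> y \<in> W \<and> smooth_on (b ` {r \<in> B. Q (h r) \<in> V} \<inter> W)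
      (\<lambda>z. \<xi> (Q (h (inv_into B b z))))"
    using smooth_on_subset by blast
qed

text \<open>The transition functions are instances of \<open>smooth_on_lifted_chart\<close> with \<open>h\<close> the identity of \<open>P\<close>.\<close>

theorem smooth_manifold_quotient:
  fixes A :: "('x, 'e::euclidean_space) chart set"
  assumes lift: "\<And>C. C \<in> A \<Longrightarrow> \<exists>D. lifts_to C D"
    and cover: "\<And>u. u \<in> P \<Longrightarrow> \<exists>(V, \<xi>)\<in>A. Q u \<in> V"
  shows "smooth_manifold DIM('e) T A"
proof -
  have "smooth_on (\<xi> ` (V \<inter> V')) (\<xi>' \<circ> inv_into V \<xi>)"
    if VA: "(V, \<xi>) \<in> A" "(V', \<xi>') \<in> A" for V \<xi> V' \<xi>'
  proof -
    obtain U c where l: "lifts_to (V, \<xi>) (U, c)" using lift[OF VA(1)] by auto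
    obtain U' c' where l': "lifts_to (V', \<xi>') (U', c')" using lift[OF VA(2)] by auto
    have c: "(U, c) \<in> submanifold_atlas P" "V = Q ` U" "\<And>u. u \<in> U \<Longrightarrow> \<xi> (Q u) = c u"
      using l by (auto simp: lifts_to_def)
    obtain U: "inj_on c U" using c(1) by (rule submanifold_atlasE)
    have "smooth_on (c ` {u \<in> U. Q u \<in> V'}) (\<lambda>z. \<xi>' (Q (inv_into U c z)))"
      by (rule smooth_on_lifted_chart[OF l' c(1) smooth_on_ident]) simp
    moreover have "\<xi> ` (V \<inter> V') = c ` {u \<in> U. Q u \<in> V'}"
      using c(2,3) by (auto simp: image_iff) (metis IntI imageI)+
    ultimately have "smooth_on (\<xi> ` (V \<inter> V')) (\<lambda>z. \<xi>' (Q (inv_into U c z)))" by simp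
    then show ?thesis
    proof (rule smooth_on_cong)
      fix z assume "z \<in> \<xi> ` (V \<inter> V')"
      then obtain u where u: "u \<in> U" "z = \<xi> (Q u)" using c(2) by auto
      moreover have "inv_into V \<xi> z = Q u"
        unfolding u(2) by (rule inv_into_f_f[OF lifted_chart_homeomorphic_map(3)[OF l]])
          (use u c(2) in blast)
      ultimately show "\<xi>' (Q (inv_into U c z)) = (\<xi>' \<circ> inv_into V \<xi>) z" using c(3) U by simp
    qed
  qed
  moreover have "openin T V \<and> open (\<xi> ` V) \<and>
      homeomorphic_map (subtopology T V) (top_of_set (\<xi> ` V)) \<xi>" if VA: "(V, \<xi>) \<in> A" for V \<xi>
  proof -
    obtain U c where l: "lifts_to (V, \<xi>) (U, c)" using lift[OF VA] by auto
    then have "open (c ` U)" by (auto simp: lifts_to_def submanifold_atlas_def)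
    then show ?thesis using lifted_chart_homeomorphic_map[OF l] by simp
  qed
  moreover have "(\<Union>(V, \<xi>)\<in>A. V) = topspace T"
  proof
    show "(\<Union>(V, \<xi>)\<in>A. V) \<subseteq> topspace T"
    proof clarify
      fix x V \<xi> assume "(V, \<xi>) \<in> A" "x \<in> V"
      then show "x \<in> topspace T"
        using lift lifted_chart_homeomorphic_map(1) openin_subset by (metis subsetD surj_pair)
    qed
    show "topspace T \<subseteq> (\<Union>(V, \<xi>)\<in>A. V)" using cover by (fastforce simp: topspace_T)
  qed
  ultimately have "smooth_atlas T A" unfolding smooth_atlas_def by auto
  then show ?thesis by (simp add: smooth_manifold_def Hausdorff_T second_countable_T)
qed

text \<open>A smooth action upstairs that is compatible with \<open>Q\<close> descends. Continuity uses that \<open>Q\<close> is open, so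
  that \<open>id \<times> Q\<close> is again a quotient map.\<close>

theorem smooth_map_quotient_action:
  fixes A :: "('x, 'e::euclidean_space) chart set" and K :: "'k::euclidean_space set"
  assumes lift: "\<And>C. C \<in> A \<Longrightarrow> \<exists>D. lifts_to C D"
    and m: "smooth_on (K \<times> P) m" "m ` (K \<times> P) \<subseteq> P"
    and act: "\<And>k u. k \<in> K \<Longrightarrow> u \<in> P \<Longrightarrow> act k (Q u) = Q (m (k, u))"
  shows "smooth_map (prod_topology (top_of_set K) T) (prod_atlas (submanifold_atlas K) A) T A
    (\<lambda>(k, x). act k x)"
  unfolding smooth_map_def
proof (intro conjI)
  show "continuous_map (prod_topology (top_of_set K) T) T (\<lambda>(k, x). act k x)"
    unfolding continuous_map_def
  proof (intro conjI allI impI)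
    show "(\<lambda>(k, x). act k x) \<in> topspace (prod_topology (top_of_set K) T) \<rightarrow> topspace T"
    proof clarify
      fix k x assume "(k, x) \<in> topspace (prod_topology (top_of_set K) T)"
      then obtain u where "k \<in> K" "u \<in> P" "x = Q u" by (auto simp: topspace_T)
      then show "act k x \<in> topspace T" using act[of k u] m(2) by (auto simp: topspace_T)
    qed
    fix V assume "openin T V"
    then have V: "openin (top_of_set P) {u \<in> P. Q u \<in> V}" by (simp add: openin_T)
    have "continuous_map (top_of_set (K \<times> P)) (top_of_set P) m"
      using smooth_on_imp_continuous_on[OF m(1)] m(2) by (auto simp: continuous_map_in_subtopology)
    from openin_continuous_map_preimage[OF this V]
    have op: "openin (prod_topology (top_of_set K) (top_of_set P))
        {z \<in> K \<times> P. m z \<in> {u \<in> P. Q u \<in> V}}" by simp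
    show "openin (prod_topology (top_of_set K) T)
        {z \<in> topspace (prod_topology (top_of_set K) T). (case z of (k, x) \<Rightarrow> act k x) \<in> V}"
      unfolding openin_prod_topology_alt
    proof (intro allI impI)
      fix k x
      assume "(k, x) \<in> {z \<in> topspace (prod_topology (top_of_set K) T).
        (case z of (k, x) \<Rightarrow> act k x) \<in> V}"
      then obtain u where u: "k \<in> K" "u \<in> P" "x = Q u" "act k (Q u) \<in> V"
        by (auto simp: topspace_T)
      then have "(k, u) \<in> {z \<in> K \<times> P. m z \<in> {u \<in> P. Q u \<in> V}}" using act m(2) by auto
      then obtain L N where LN: "openin (top_of_set K) L" "openin (top_of_set P) N" "k \<in> L" "u \<in> N"
        "L \<times> N \<subseteq> {z \<in> K \<times> P. m z \<in> {u \<in> P. Q u \<in> V}}"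
        using op unfolding openin_prod_topology_alt by meson
      have "L \<times> Q ` N \<subseteq> {z \<in> topspace (prod_topology (top_of_set K) T).
          (case z of (k, x) \<Rightarrow> act k x) \<in> V}"
      proof
        fix z assume "z \<in> L \<times> Q ` N"
        then obtain l v where z: "z = (l, Q v)" "l \<in> L" "v \<in> N" by blast
        then have "l \<in> K" "v \<in> P" "Q (m (l, v)) \<in> V" using LN(5) by auto
        then show "z \<in> {z \<in> topspace (prod_topology (top_of_set K) T).
          (case z of (k, x) \<Rightarrow> act k x) \<in> V}" using act z(1) by (simp add: topspace_T)
      qed
      then show "\<exists>U W. openin (top_of_set K) U \<and> openin T W \<and> k \<in> U \<and> x \<in> W \<and> U \<times> W \<subseteq>
          {z \<in> topspace (prod_topology (top_of_set K) T). (case z of (k, x) \<Rightarrow> act k x) \<in> V}"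
        using LN(1,3,4) openin_T_image[OF LN(2)] u(3) by blast
    qed
  qed
next
  show "\<forall>(B, b)\<in>prod_atlas (submanifold_atlas K) A. \<forall>(V', \<xi>')\<in>A.
      smooth_on (b ` (B \<inter> (\<lambda>(k, x). act k x) -` V')) (\<xi>' \<circ> (\<lambda>(k, x). act k x) \<circ> inv_into B b)"
  proof (intro ballI, unfold split_paired_all, simp only: prod.case, intro ballI,
      unfold split_paired_all, simp only: prod.case)
    fix B b V' \<xi>'
    assume "(B, b) \<in> prod_atlas (submanifold_atlas K) A" and V': "(V', \<xi>') \<in> A"
    then obtain L \<phi> V \<xi> where Bb: "B = L \<times> V" "b = map_prod \<phi> \<xi>" "(L, \<phi>) \<in> submanifold_atlas K"
      "(V, \<xi>) \<in> A" unfolding prod_atlas_def by blast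
    obtain U c where l: "lifts_to (V, \<xi>) (U, c)" using lift[OF Bb(4)] by auto
    obtain U' c' where l': "lifts_to (V', \<xi>') (U', c')" using lift[OF V'] by auto
    have c: "(U, c) \<in> submanifold_atlas P" "V = Q ` U" "\<And>u. u \<in> U \<Longrightarrow> \<xi> (Q u) = c u"
      using l by (auto simp: lifts_to_def)
    have \<phi>c: "(L \<times> U, map_prod \<phi> c) \<in> submanifold_atlas (K \<times> P)"
      by (rule submanifold_atlas_Times[OF Bb(3) c(1)])
    obtain L: "L \<subseteq> K" "inj_on \<phi> L" using Bb(3) by (rule submanifold_atlasE)
    obtain U: "U \<subseteq> P" using c(1) by (rule submanifold_atlasE)
    obtain inj: "inj_on (map_prod \<phi> c) (L \<times> U)" using \<phi>c by (rule submanifold_atlasE)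
    have injb: "inj_on b B"
      unfolding Bb(1,2) by (rule map_prod_inj_on[OF L(2) lifted_chart_homeomorphic_map(3)[OF l]])
    have "smooth_on (map_prod \<phi> c ` {z \<in> L \<times> U. Q (m z) \<in> V'})
        (\<lambda>z. \<xi>' (Q (m (inv_into (L \<times> U) (map_prod \<phi> c) z))))"
      by (rule smooth_on_lifted_chart[OF l' \<phi>c m])
    moreover have "b ` (B \<inter> (\<lambda>(k, x). act k x) -` V') \<subseteq> map_prod \<phi> c ` {z \<in> L \<times> U. Q (m z) \<in> V'}"
    proof
      fix z assume "z \<in> b ` (B \<inter> (\<lambda>(k, x). act k x) -` V')"
      then obtain k x where z: "z = b (k, x)" and kx: "(k, x) \<in> B" "act k x \<in> V'" by auto
      then obtain u where u: "u \<in> U" "x = Q u" "k \<in> L" using Bb(1) c(2) by auto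
      moreover from this have "k \<in> K" "u \<in> P" using L(1) U by blast+
      ultimately have "(k, u) \<in> {z \<in> L \<times> U. Q (m z) \<in> V'}" using kx(2) act[of k u] by simp
      moreover have "z = map_prod \<phi> c (k, u)" using z u c(3) Bb(2) by simp
      ultimately show "z \<in> map_prod \<phi> c ` {z \<in> L \<times> U. Q (m z) \<in> V'}" by (rule rev_image_eqI)
    qed
    ultimately have "smooth_on (b ` (B \<inter> (\<lambda>(k, x). act k x) -` V'))
        (\<lambda>z. \<xi>' (Q (m (inv_into (L \<times> U) (map_prod \<phi> c) z))))"
      by (rule smooth_on_subset)
    then show "smooth_on (b ` (B \<inter> (\<lambda>(k, x). act k x) -` V'))
        (\<xi>' \<circ> (\<lambda>(k, x). act k x) \<circ> inv_into B b)"
    proof (rule smooth_on_cong)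
      fix z assume "z \<in> b ` (B \<inter> (\<lambda>(k, x). act k x) -` V')"
      then obtain k u where ku: "k \<in> L" "u \<in> U" "z = b (k, Q u)" "(k, Q u) \<in> B"
        using Bb(1) c(2) by auto
      have "z = map_prod \<phi> c (k, u)" using ku c(3) Bb(2) by simp
      then have "inv_into (L \<times> U) (map_prod \<phi> c) z = (k, u)"
        using inv_into_f_f[OF inj, of "(k, u)"] ku(1,2) by simp
      moreover have "inv_into B b z = (k, Q u)"
        unfolding ku(3) by (rule inv_into_f_f[OF injb ku(4)])
      ultimately show "\<xi>' (Q (m (inv_into (L \<times> U) (map_prod \<phi> c) z))) =
          (\<xi>' \<circ> (\<lambda>(k, x). act k x) \<circ> inv_into B b) z"
        using act[of k u] ku(1,2) L(1) U by (simp add: subset_iff)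
    qed
  qed
qed

end

section \<open>Rotations\<close>

lemmas mat3_simps = vec_eq_iff forall_3 sum_3 matrix_matrix_mult_def transpose_def mat_def

lemma SO3_iff: "k \<in> SO3 \<longleftrightarrow> transpose k ** k = mat 1 \<and> det k = 1"
  by (simp add: SO3_def orthogonal_matrix)

lemma SO3_mult_transpose:
  assumes "k \<in> SO3"
  shows "transpose k ** k = mat 1" "k ** transpose k = mat 1"
  using assms by (auto simp: SO3_def orthogonal_matrix_def)

lemma matrix_inv_SO3:
  assumes "k \<in> SO3" shows "matrix_inv k = transpose k"
proof -
  have "matrix_inv k ** k = mat 1"
    unfolding matrix_inv_def
    by (rule someI2[where a = "transpose k"]) (use SO3_mult_transpose[OF assms] in auto)
  then have "matrix_inv k ** k ** transpose k = transpose k" by simp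
  then show ?thesis by (simp add: SO3_mult_transpose[OF assms] flip: matrix_mul_assoc)
qed

lemma SO3_mat_1: "mat 1 \<in> SO3"
  by (simp add: SO3_iff transpose_mat)

lemma SO3_mult: "k \<in> SO3 \<Longrightarrow> l \<in> SO3 \<Longrightarrow> k ** l \<in> SO3"
  by (simp add: SO3_def orthogonal_matrix_mul det_mul)

lemma SO3_transpose: "k \<in> SO3 \<Longrightarrow> transpose k \<in> SO3"
  by (simp add: SO3_def det_transpose)

lemma SO3_cancel:
  assumes "k \<in> SO3"
  shows "transpose k ** (k ** A) = A" "k ** (transpose k ** A) = A"
    "A ** transpose k ** k = A" "A ** k ** transpose k = A"
  using SO3_mult_transpose[OF assms] by (metis matrix_mul_assoc matrix_mul_lid matrix_mul_rid)+

lemma group_SO3_group: "Group.group SO3_group"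
proof (rule groupI)
  fix x assume "x \<in> carrier SO3_group"
  then show "\<exists>y\<in>carrier SO3_group. y \<otimes>\<^bsub>SO3_group\<^esub> x = \<one>\<^bsub>SO3_group\<^esub>"
    using SO3_transpose SO3_mult_transpose by (auto simp: SO3_group_def)
qed (auto simp: SO3_group_def SO3_mult SO3_mat_1 matrix_mul_assoc)

lemma inv_SO3_group: "k \<in> SO3 \<Longrightarrow> inv\<^bsub>SO3_group\<^esub> k = transpose k"
  by (rule group.inv_equality[OF group_SO3_group])
    (auto simp: SO3_group_def SO3_mult_transpose SO3_transpose)

lemma SO3_rows:
  assumes "k \<in> SO3"
  shows "k$1$1*k$1$1 + k$1$2*k$1$2 + k$1$3*k$1$3 = 1" "k$2$1*k$2$1 + k$2$2*k$2$2 + k$2$3*k$2$3 = 1"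
    "k$3$1*k$3$1 + k$3$2*k$3$2 + k$3$3*k$3$3 = 1" "k$1$1*k$2$1 + k$1$2*k$2$2 + k$1$3*k$2$3 = 0"
    "k$1$1*k$3$1 + k$1$2*k$3$2 + k$1$3*k$3$3 = 0" "k$2$1*k$3$1 + k$2$2*k$3$2 + k$2$3*k$3$3 = 0"
  using SO3_mult_transpose(2)[OF assms] by (simp_all add: mat3_simps)

lemma SO3_columns:
  assumes "k \<in> SO3"
  shows "k$1$1*k$1$1 + k$2$1*k$2$1 + k$3$1*k$3$1 = 1" "k$1$2*k$1$2 + k$2$2*k$2$2 + k$3$2*k$3$2 = 1"
    "k$1$3*k$1$3 + k$2$3*k$2$3 + k$3$3*k$3$3 = 1" "k$1$1*k$1$2 + k$2$1*k$2$2 + k$3$1*k$3$2 = 0"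
    "k$1$1*k$1$3 + k$2$1*k$2$3 + k$3$1*k$3$3 = 0" "k$1$2*k$1$3 + k$2$2*k$2$3 + k$3$2*k$3$3 = 0"
  using SO3_mult_transpose(1)[OF assms] by (simp_all add: mat3_simps)

text \<open>A rotation preserves the cross product, so each column is the cross product of the other two;
  equivalently, a rotation equals its own cofactor matrix.\<close>

lemma SO3_cofactors:
  assumes "k \<in> SO3"
  shows "k$1$1 = k$2$2*k$3$3 - k$2$3*k$3$2" "k$2$2 = k$1$1*k$3$3 - k$1$3*k$3$1"
    "k$3$3 = k$1$1*k$2$2 - k$1$2*k$2$1" "k$1$2 = k$2$3*k$3$1 - k$2$1*k$3$3"
    "k$2$1 = k$1$3*k$3$2 - k$1$2*k$3$3" "k$1$3 = k$2$1*k$3$2 - k$2$2*k$3$1"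
    "k$3$1 = k$1$2*k$2$3 - k$1$3*k$2$2" "k$2$3 = k$1$2*k$3$1 - k$1$1*k$3$2"
    "k$3$2 = k$1$3*k$2$1 - k$1$1*k$2$3"
proof -
  have "cross3 (k *v axis i 1) (k *v axis j 1) = k *v cross3 (axis i 1) (axis j 1)" for i j
    using cross_orthogonal_matrix[of k "axis i 1" "axis j 1"] assms by (simp add: SO3_def)
  from this[of 1 2] this[of 2 3] this[of 3 1]
  show "k$1$1 = k$2$2*k$3$3 - k$2$3*k$3$2" "k$2$2 = k$1$1*k$3$3 - k$1$3*k$3$1"
    "k$3$3 = k$1$1*k$2$2 - k$1$2*k$2$1" "k$1$2 = k$2$3*k$3$1 - k$2$1*k$3$3"
    "k$2$1 = k$1$3*k$3$2 - k$1$2*k$3$3" "k$1$3 = k$2$1*k$3$2 - k$2$2*k$3$1"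
    "k$3$1 = k$1$2*k$2$3 - k$1$3*k$2$2" "k$2$3 = k$1$2*k$3$1 - k$1$1*k$3$2"
    "k$3$2 = k$1$3*k$2$1 - k$1$1*k$2$3"
    by (simp_all add: cross3_simps matrix_vector_mult_def sum_3 axis_def vec_eq_iff forall_3)
qed

section \<open>The Cayley chart of the rotation group\<close>

definition outer :: "real^3 \<Rightarrow> real^3 \<Rightarrow> mat3" where
  "outer a b = (\<chi> i j. a$i * b$j)"

definition hat :: "real^3 \<Rightarrow> mat3" where
  "hat a = vector [vector [0, - a$3, a$2], vector [a$3, 0, - a$1], vector [- a$2, a$1, 0]]"

definition axial :: "mat3 \<Rightarrow> real^3" where
  "axial k = vector [k$3$2 - k$2$3, k$1$3 - k$3$1, k$2$1 - k$1$2]"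

definition cayley_num :: "real^3 \<Rightarrow> mat3" where
  "cayley_num a = (1 + (-1) * (a \<bullet> a)) *\<^sub>R mat 1 + 2 *\<^sub>R outer a a + 2 *\<^sub>R hat a"

text \<open>The rotation by the angle \<open>2 * arctan (norm a)\<close> about the axis \<open>a\<close>, given by the quaternion with
  real part \<open>1\<close> and imaginary part \<open>a\<close>; equivalently \<open>(1 + hat a) (1 - hat a)\<^sup>-\<^sup>1\<close>.\<close>

definition cayley :: "real^3 \<Rightarrow> mat3" where
  "cayley a = inverse (1 + a \<bullet> a) *\<^sub>R cayley_num a"

definition cayley_inv :: "mat3 \<Rightarrow> real^3" where
  "cayley_inv k = inverse (1 + trace k) *\<^sub>R axial k"

lemma inner_3: "a \<bullet> b = a$1 * b$1 + a$2 * b$2 + a$3 * b$3" for a b :: "real^3"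
  by (simp add: inner_vec_def sum_3)

lemma trace_3: "trace k = k$1$1 + k$2$2 + k$3$3" for k :: mat3
  by (simp add: trace_def sum_3)

lemma one_plus_inner_pos: "1 + a \<bullet> a > 0" for a :: "real^3"
  by (simp add: add_pos_nonneg)

lemma cayley_num_entries:
  "cayley_num a$1$1 = 1 + a$1*a$1 - a$2*a$2 - a$3*a$3" "cayley_num a$1$2 = 2*(a$1*a$2 - a$3)"
  "cayley_num a$2$2 = 1 - a$1*a$1 + a$2*a$2 - a$3*a$3" "cayley_num a$2$1 = 2*(a$1*a$2 + a$3)"
  "cayley_num a$3$3 = 1 - a$1*a$1 - a$2*a$2 + a$3*a$3" "cayley_num a$1$3 = 2*(a$1*a$3 + a$2)"
  "cayley_num a$3$1 = 2*(a$1*a$3 - a$2)" "cayley_num a$2$3 = 2*(a$2*a$3 - a$1)"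
  "cayley_num a$3$2 = 2*(a$2*a$3 + a$1)"
  by (simp_all add: cayley_num_def inner_3 outer_def hat_def mat_def)

lemma cayley_in_SO3: "cayley a \<in> SO3"
proof -
  let ?N = "cayley_num a" and ?D = "1 + a \<bullet> a"
  have "transpose ?N ** ?N = (?D * ?D) *\<^sub>R mat 1"
    by (simp add: mat3_simps cayley_num_entries inner_3) (intro conjI; algebra)
  moreover have "transpose (r *\<^sub>R ?N) ** (r *\<^sub>R ?N) = (r * r) *\<^sub>R (transpose ?N ** ?N)" for r
    by (simp add: mat3_simps algebra_simps)
  moreover have "det ?N = ?D * ?D * ?D"
    unfolding det_3 cayley_num_entries inner_3 by algebra
  moreover have "det (r *\<^sub>R ?N) = r * r * r * det ?N" for r
    by (simp add: det_3 algebra_simps)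
  moreover have "inverse r * inverse r * (r * r) = 1"
    "inverse r * inverse r * inverse r * (r * r * r) = 1" if "r > 0" for r :: real
    using that by (auto simp: field_simps)
  ultimately show ?thesis using one_plus_inner_pos[of a] by (simp add: SO3_iff cayley_def)
qed

lemma trace_cayley: "1 + trace (cayley a) = 4 / (1 + a \<bullet> a)"
proof -
  have "trace (cayley a) = inverse (1 + a \<bullet> a) * (cayley_num a$1$1 + cayley_num a$2$2 + cayley_num a$3$3)"
    by (simp add: trace_3 cayley_def distrib_left)
  also have "cayley_num a$1$1 + cayley_num a$2$2 + cayley_num a$3$3 = 4 - (1 + a \<bullet> a)"
    by (simp add: cayley_num_entries inner_3)
  finally show ?thesis using one_plus_inner_pos[of a] by (simp add: field_simps)
qed

lemma cayley_inv_cayley: "cayley_inv (cayley a) = a"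
proof -
  have "axial (r *\<^sub>R cayley_num a) = (4 * r) *\<^sub>R a" for r
    by (simp add: vec_eq_iff forall_3 axial_def cayley_num_entries algebra_simps)
  then show ?thesis
    using one_plus_inner_pos[of a]
    by (simp only: cayley_inv_def trace_cayley) (simp add: cayley_def)
qed

text \<open>With \<open>d = 1 + trace k\<close>, the identities \<open>v v\<^sup>T = d (k + k\<^sup>T + (2 - d) 1)\<close> and
  \<open>v \<bullet> v = d (4 - d)\<close> for \<open>v = axial k\<close> turn the formula for \<open>cayley\<close> into \<open>k\<close>.\<close>

lemma cayley_cayley_inv:
  assumes k: "k \<in> SO3" and d: "1 + trace k \<noteq> 0"
  shows "cayley (cayley_inv k) = k"
proof -
  define d where "d = 1 + trace k"
  define v where "v = axial k"
  note e = SO3_rows[OF k] SO3_columns[OF k] SO3_cofactors[OF k]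
  have v: "v$1 = k$3$2 - k$2$3" "v$2 = k$1$3 - k$3$1" "v$3 = k$2$1 - k$1$2"
    by (simp_all add: v_def axial_def)
  have off: "v$1 * v$2 = d * (k$1$2 + k$2$1)" "v$1 * v$3 = d * (k$1$3 + k$3$1)"
    "v$2 * v$3 = d * (k$2$3 + k$3$2)"
    using e unfolding v d_def trace_3 by (algebra)+
  have diag: "v$1 * v$1 = d * (2 * k$1$1 + 2 - d)" "v$2 * v$2 = d * (2 * k$2$2 + 2 - d)"
    "v$3 * v$3 = d * (2 * k$3$3 + 2 - d)"
    using e unfolding v d_def trace_3 by (algebra)+
  have vv: "v \<bullet> v = d * (4 - d)"
    unfolding inner_3 diag by (simp add: d_def trace_3 algebra_simps)
  have d0: "d \<noteq> 0" using d by (simp add: d_def)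
  define a where "a = cayley_inv k"
  have a: "a = inverse d *\<^sub>R v" by (simp add: a_def cayley_inv_def d_def v_def)
  have aa: "a \<bullet> a = 4 / d - 1"
    unfolding a using d0 by (simp add: vv field_simps)
  have cay: "cayley a = (d / 4) *\<^sub>R
      ((2 + (- 4 / d)) *\<^sub>R mat 1 + 2 *\<^sub>R (inverse (d * d) *\<^sub>R outer v v) + (2 / d) *\<^sub>R hat v)"
    unfolding cayley_def cayley_num_def aa using d0
    by (simp add: a outer_def hat_def vec_eq_iff forall_3 field_simps)
  have "cayley a = k"
    unfolding cay using d0
    by (simp add: vec_eq_iff forall_3 outer_def hat_def mat_def off diag
        off[unfolded mult.commute[of "v$1"] mult.commute[of "v$2" "v$3"]])
      (simp add: v field_simps)
  then show ?thesis by (simp add: a_def)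
qed

lemma bounded_linear_euclideanI:
  fixes f :: "'a::euclidean_space \<Rightarrow> 'b::real_normed_vector"
  shows "(\<And>x y. f (x + y) = f x + f y) \<Longrightarrow> (\<And>c x. f (c *\<^sub>R x) = c *\<^sub>R f x) \<Longrightarrow> bounded_linear f"
  by (auto simp: linear_iff linear_conv_bounded_linear[symmetric])

lemma smooth_on_cayley: "smooth_on S cayley"
proof -
  have "bounded_bilinear outer"
    unfolding bilinear_conv_bounded_bilinear[symmetric] bilinear_def outer_def
    by (auto intro!: linearI simp: vec_eq_iff algebra_simps)
  moreover have "bounded_linear hat"
    by (rule bounded_linear_euclideanI) (simp_all add: hat_def vec_eq_iff forall_3)
  ultimately show ?thesis
    unfolding cayley_def cayley_num_def using one_plus_inner_pos
    by (intro smooth_on_intros smooth_on_bilinear[OF bounded_bilinear_inner]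
        smooth_on_bilinear[of outer] smooth_on_linear_comp[of hat]) (auto simp: less_imp_neq[symmetric])
qed

lemma bounded_linear_trace: "bounded_linear (trace :: mat3 \<Rightarrow> real)"
  by (rule bounded_linear_euclideanI) (simp_all add: trace_3 algebra_simps)

lemma smooth_on_cayley_inv:
  assumes "\<And>k. k \<in> S \<Longrightarrow> 1 + trace k \<noteq> 0"
  shows "smooth_on S cayley_inv"
proof -
  have "bounded_linear axial"
    by (rule bounded_linear_euclideanI) (simp_all add: axial_def vec_eq_iff forall_3 algebra_simps)
  then show ?thesis
    unfolding cayley_inv_def using assms
    by (intro smooth_on_intros smooth_on_bounded_linear[of axial]
        smooth_on_bounded_linear[OF bounded_linear_trace]) auto
qed

lemma submanifold_atlasI:
  assumes "openin (top_of_set S) U" "open V" "smooth_on U \<phi>" "smooth_on V \<psi>"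
    and "\<And>u. u \<in> U \<Longrightarrow> \<phi> u \<in> V \<and> \<psi> (\<phi> u) = u" "\<And>v. v \<in> V \<Longrightarrow> \<psi> v \<in> U \<and> \<phi> (\<psi> v) = v"
  shows "(U, \<phi>) \<in> submanifold_atlas S"
proof -
  have im: "\<phi> ` U = V" using assms(5,6) by (metis image_eqI image_subsetI subsetI subset_antisym)
  have inj: "inj_on \<phi> U" using assms(5) by (metis inj_onI)
  have "smooth_on V (inv_into U \<phi>)"
  proof (rule smooth_on_cong[OF assms(4)])
    fix v assume "v \<in> V"
    then show "\<psi> v = inv_into U \<phi> v" using assms(6) inv_into_f_f[OF inj, of "\<psi> v"] by metis
  qed
  then show ?thesis unfolding submanifold_atlas_def using assms(1-3) im inj by simp
qed

text \<open>The Cayley chart, translated to \<open>l\<close>, misses exactly the rotations by \<open>\<pi>\<close> relative to \<open>l\<close>.\<close>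

lemma SO3_atlas_covers:
  assumes l: "l \<in> SO3"
  obtains U \<phi> where "(U, \<phi>) \<in> SO3_atlas" "l \<in> U"
proof
  let ?U = "SO3 \<inter> (\<lambda>k. 1 + trace (transpose l ** k)) -` (- {0})"
  have sm: "smooth_on S (\<lambda>k. transpose l ** k)" for S
    by (intro smooth_on_intros)
  have "continuous_on UNIV (\<lambda>k. 1 + trace (transpose l ** k))"
    by (intro continuous_on_add continuous_on_const smooth_on_imp_continuous_on
        smooth_on_linear_comp[OF bounded_linear_trace] sm)
  then have "open ((\<lambda>k. 1 + trace (transpose l ** k)) -` (- {0}))"
    by (intro open_vimage open_Compl closed_singleton)
  then have "openin (top_of_set SO3) ?U" by (rule openin_open_Int)
  then show "(?U, \<lambda>k. cayley_inv (transpose l ** k)) \<in> SO3_atlas"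
    unfolding SO3_atlas_def
  proof (rule submanifold_atlasI[OF _ open_UNIV, where \<psi> = "\<lambda>a. l ** cayley a"])
    show "smooth_on ?U (\<lambda>k. cayley_inv (transpose l ** k))"
      by (rule smooth_on_compose[OF sm smooth_on_cayley_inv[of "{k. 1 + trace k \<noteq> 0}"]]) auto
    show "smooth_on UNIV (\<lambda>a. l ** cayley a)"
      by (intro smooth_on_intros smooth_on_cayley)
    fix k assume "k \<in> ?U"
    then show "cayley_inv (transpose l ** k) \<in> UNIV \<and>
        l ** cayley (cayley_inv (transpose l ** k)) = k"
      using l by (simp add: cayley_cayley_inv SO3_mult SO3_transpose SO3_cancel)
  next
    fix a :: "real^3"
    show "l ** cayley a \<in> ?U \<and> cayley_inv (transpose l ** (l ** cayley a)) = a"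
      using l one_plus_inner_pos[of a]
      by (simp add: SO3_mult cayley_in_SO3 SO3_cancel cayley_inv_cayley trace_cayley)
  qed
  show "l \<in> ?U" using l by (simp add: SO3_mult_transpose trace_3 mat_def)
qed

section \<open>Conjugation by rotations\<close>

lemma conj_mat_SO3: "k \<in> SO3 \<Longrightarrow> conj_mat k X = k ** X ** transpose k"
  by (simp add: conj_mat_def matrix_inv_SO3)

lemma linear_conj_mat: "linear (conj_mat k)"
  unfolding conj_mat_def
  by (intro bounded_linear.linear bounded_linear_compose[OF
        bounded_bilinear.bounded_linear_left[OF bounded_bilinear_matrix_mult]
        bounded_bilinear.bounded_linear_right[OF bounded_bilinear_matrix_mult]])

lemma conj_mat_mult:
  "k \<in> SO3 \<Longrightarrow> l \<in> SO3 \<Longrightarrow> conj_mat (k ** l) X = conj_mat k (conj_mat l X)"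
  by (simp add: conj_mat_SO3 SO3_mult matrix_transpose_mul matrix_mul_assoc)

lemma conj_mat_1: "conj_mat (mat 1) X = X"
  by (simp add: conj_mat_SO3 SO3_mat_1 transpose_mat)

lemma conj_set_mult: "k \<in> SO3 \<Longrightarrow> l \<in> SO3 \<Longrightarrow> conj_set (k ** l) W = conj_set k (conj_set l W)"
  by (auto simp: conj_set_def conj_mat_mult image_image)

lemma conj_set_1: "conj_set (mat 1) W = W"
  by (simp add: conj_set_def conj_mat_1)

lemma conj_set_span: "conj_set k (span S) = span (conj_mat k ` S)"
  by (simp add: conj_set_def linear_span_image[OF linear_conj_mat])

lemma conj_set_cancel: "k \<in> SO3 \<Longrightarrow> conj_set (transpose k) (conj_set k W) = W"
  by (simp add: conj_set_1 SO3_mult_transpose SO3_transpose flip: conj_set_mult)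

lemma conj_mat_in_\<pp>: "k \<in> SO3 \<Longrightarrow> X \<in> \<pp> \<Longrightarrow> conj_mat k X \<in> \<pp>"
  by (simp add: \<pp>_def conj_mat_SO3 matrix_transpose_mul matrix_mul_assoc trace_mul_sym[of _ "transpose k"]
      SO3_mult_transpose)

lemma inj_conj_mat: "k \<in> SO3 \<Longrightarrow> inj (conj_mat k)"
  by (rule inj_on_inverseI[of _ "conj_mat (transpose k)"])
    (simp add: conj_mat_1 SO3_mult_transpose SO3_transpose flip: conj_mat_mult)

section \<open>The slice in affine coordinates\<close>

abbreviation Y_aff :: "real \<times> real \<Rightarrow> mat3" where
  "Y_aff p \<equiv> Y_mat 1 (fst p) (snd p)"

text \<open>On \<open>\<Y>'\<close> the first coordinate can be normalized to \<open>1\<close>; the remaining two then range over the plane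
  without its coordinate axes.\<close>

definition quadrants :: "(real \<times> real) set" where
  "quadrants = {p. fst p \<noteq> 0 \<and> snd p \<noteq> 0}"

lemma open_quadrants: "open quadrants"
  unfolding quadrants_def by (intro open_Collect_conj open_Collect_neq continuous_intros)

definition aff_line :: "real \<times> real \<Rightarrow> mat3 set" where
  "aff_line p = line (Y_aff p)"

lemma X0_entries:
  "X0$1$1 = 1" "X0$2$2 = 1" "X0$3$3 = -2" "X0$1$2 = 0" "X0$2$1 = 0" "X0$1$3 = 0" "X0$3$1 = 0"
  "X0$2$3 = 0" "X0$3$2 = 0"
  by (simp_all add: X0_def)

lemma Y_mat_entries:
  "Y_mat a d e$1$1 = a" "Y_mat a d e$2$2 = - a" "Y_mat a d e$3$3 = 0" "Y_mat a d e$1$2 = 0"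
  "Y_mat a d e$2$1 = 0" "Y_mat a d e$1$3 = d" "Y_mat a d e$3$1 = d" "Y_mat a d e$2$3 = e"
  "Y_mat a d e$3$2 = e"
  by (simp_all add: Y_mat_def)

lemma scaleR_Y_mat: "c *\<^sub>R Y_mat a d e = Y_mat (c * a) (c * d) (c * e)"
  by (simp add: vec_eq_iff forall_3 Y_mat_entries)

lemma Y_mat_inject: "Y_mat a d e = Y_mat a' d' e' \<longleftrightarrow> a = a' \<and> d = d' \<and> e = e'"
  by (auto simp: vec_eq_iff forall_3 Y_mat_entries)

lemma line_scaleR: "c \<noteq> 0 \<Longrightarrow> line (c *\<^sub>R Y) = line Y"
  unfolding line_def by (rule span_image_scale[of "{Y}" "\<lambda>_. c", simplified])

lemma line_eq_aff_line: "line (Y_mat a d e) = aff_line p \<longleftrightarrow> a \<noteq> 0 \<and> p = (d / a, e / a)"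
proof
  assume eq: "line (Y_mat a d e) = aff_line p"
  have "Y_aff p \<in> line (Y_mat a d e)" unfolding eq unfolding aff_line_def line_def by (simp add: span_base)
  then obtain c where "Y_aff p = c *\<^sub>R Y_mat a d e" by (auto simp: line_def span_singleton)
  then have "1 = c * a" "fst p = c * d" "snd p = c * e" by (simp_all add: scaleR_Y_mat Y_mat_inject)
  moreover from this have "a \<noteq> 0" by auto
  moreover from this \<open>1 = c * a\<close> have "c = 1 / a" by (simp add: field_simps)
  ultimately show "a \<noteq> 0 \<and> p = (d / a, e / a)" by (simp add: prod_eq_iff)
next
  assume a: "a \<noteq> 0 \<and> p = (d / a, e / a)"
  then have "Y_mat a d e = a *\<^sub>R Y_aff p" by (simp add: scaleR_Y_mat)
  then show "line (Y_mat a d e) = aff_line p" using a by (simp add: aff_line_def line_scaleR)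
qed

lemma inj_aff_line: "inj aff_line"
proof (rule injI)
  fix p q assume "aff_line p = aff_line q"
  then show "p = q" using line_eq_aff_line[of 1 "fst p" "snd p" q] by (simp add: aff_line_def)
qed

lemma \<Y>'_eq: "\<Y>' = aff_line ` quadrants"
proof (intro equalityI subsetI)
  fix L assume "L \<in> \<Y>'"
  then obtain a d e where L: "L = line (Y_mat a d e)" "a \<noteq> 0" "d \<noteq> 0" "e \<noteq> 0"
    by (auto simp: \<Y>'_def)
  then have "L = aff_line (d / a, e / a)" by (simp add: line_eq_aff_line)
  then show "L \<in> aff_line ` quadrants" using L by (auto simp: quadrants_def)
next
  fix L assume "L \<in> aff_line ` quadrants"
  then obtain d e where "L = line (Y_mat 1 d e)" "d \<noteq> 0" "e \<noteq> 0"
    by (auto simp: aff_line_def quadrants_def)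
  then show "L \<in> \<Y>'" unfolding \<Y>'_def
    by (intro CollectI exI[of _ 1] exI[of _ d] exI[of _ e]) simp
qed

lemma continuous_on_Y_mat:
  assumes "continuous_on S a" "continuous_on S d" "continuous_on S e"
  shows "continuous_on S (\<lambda>x. Y_mat (a x) (d x) (e x))"
proof -
  have "bounded_linear (\<lambda>p. Y_mat (fst p) (fst (snd p)) (snd (snd p)))"
    by (rule bounded_linear_euclideanI) (simp_all add: vec_eq_iff forall_3 Y_mat_entries)
  from bounded_linear.continuous_on[OF this continuous_on_Pair[OF assms(1) continuous_on_Pair[OF assms(2,3)]]]
  show ?thesis by simp
qed

text \<open>The set of matrices whose line belongs to a given set of affine lines is described by a condition on
  the ratios of their entries to the first one. These are continuous where the first entry does not vanish, so the quotient
  topology on lines is the Euclidean topology in the affine chart.\<close>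

lemma homeomorphic_map_aff_line:
  "homeomorphic_map (top_of_set quadrants) (subtopology \<Y>_topology \<Y>') aff_line"
proof -
  define S where "S = {Y_mat a d e | a d e. (a, d, e) \<noteq> (0, 0, 0)}"
  have Ytop: "\<Y>_topology = quotient_topology (top_of_set S) line"
    by (simp add: \<Y>_topology_def S_def)
  have Y_aff: "Y_aff p \<in> S" for p unfolding S_def by fastforce
  have "continuous_map (top_of_set quadrants) (top_of_set S) Y_aff"
    using Y_aff by (auto simp: continuous_map_in_subtopology intro!: continuous_on_Y_mat continuous_intros)
  from continuous_map_compose[OF this continuous_map_quotient_topology[of "top_of_set S" line]]
  have "continuous_map (top_of_set quadrants) \<Y>_topology aff_line"
    by (simp add: Ytop o_def aff_line_def[abs_def])
  then have cont: "continuous_map (top_of_set quadrants) (subtopology \<Y>_topology \<Y>') aff_line"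
    by (auto simp: continuous_map_in_subtopology \<Y>'_eq)
  have opn: "openin \<Y>_topology (aff_line ` U)" if U: "open U" for U
    unfolding Ytop
  proof (rule openin_quotient_topology[THEN iffD2, OF conjI])
    show "aff_line ` U \<subseteq> line ` topspace (top_of_set S)"
      using Y_aff by (auto simp: aff_line_def)
    define G where "G = {Y::mat3. Y$1$1 \<noteq> 0} \<inter> (\<lambda>Y. (Y$1$3 / Y$1$1, Y$2$3 / Y$1$1)) -` U"
    have "open {Y::mat3. Y$1$1 \<noteq> 0}"
      by (intro open_Collect_neq continuous_intros)
    then have "open G"
      unfolding G_def
      by (intro continuous_open_preimage U continuous_on_Pair continuous_on_divide continuous_intros) auto
    moreover have "{Y \<in> topspace (top_of_set S). line Y \<in> aff_line ` U} = S \<inter> G"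
      by (auto simp: S_def G_def line_eq_aff_line image_iff Y_mat_entries)
    ultimately show "openin (top_of_set S) {Y \<in> topspace (top_of_set S). line Y \<in> aff_line ` U}"
      by (simp add: openin_open_Int)
  qed
  show ?thesis
  proof (rule bijective_open_imp_homeomorphic_map[OF cont])
    show "open_map (top_of_set quadrants) (subtopology \<Y>_topology \<Y>') aff_line"
      unfolding open_map_def
    proof (intro allI impI)
      fix U assume U: "openin (top_of_set quadrants) U"
      then have "openin \<Y>_topology (aff_line ` U)" using open_quadrants opn openin_open_trans by blast
      moreover have "aff_line ` U \<subseteq> \<Y>'" using openin_imp_subset[OF U] by (auto simp: \<Y>'_eq)
      ultimately show "openin (subtopology \<Y>_topology \<Y>') (aff_line ` U)"
        by (auto simp: openin_subtopology)
    qed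
    have "\<Y>' \<subseteq> topspace \<Y>_topology" using openin_subset[OF opn[OF open_quadrants]] by (simp add: \<Y>'_eq)
    then show "aff_line ` topspace (top_of_set quadrants) = topspace (subtopology \<Y>_topology \<Y>')"
      by (auto simp: \<Y>'_eq topspace_subtopology)
    show "inj_on aff_line (topspace (top_of_set quadrants))"
      using inj_aff_line by (rule inj_on_subset) simp
  qed
qed

text \<open>The three affine charts of the projective plane in the coordinates of the first one. They are
  rational, with denominators that do not vanish on \<open>quadrants\<close>.\<close>

lemma aff_chart_1: "inv_into UNIV (\<lambda>(s, t). line (Y_mat 1 s t)) (aff_line p) = p"
  unfolding inv_into_def
  by (rule some_equality) (auto simp: line_eq_aff_line split: prod.splits)

lemma aff_chart_2:
  assumes "p \<in> quadrants"
  shows "inv_into UNIV (\<lambda>(s, t). line (Y_mat s 1 t)) (aff_line p) = (1 / fst p, snd p / fst p)"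
  unfolding inv_into_def
  by (rule some_equality)
    (use assms in \<open>auto simp: line_eq_aff_line quadrants_def prod_eq_iff field_simps split: prod.splits\<close>)

lemma aff_chart_3:
  assumes "p \<in> quadrants"
  shows "inv_into UNIV (\<lambda>(s, t). line (Y_mat s t 1)) (aff_line p) = (1 / snd p, fst p / snd p)"
  unfolding inv_into_def
  by (rule some_equality)
    (use assms in \<open>auto simp: line_eq_aff_line quadrants_def prod_eq_iff field_simps split: prod.splits\<close>)

lemma \<Y>_atlas_aff_line:
  assumes "(B, \<psi>) \<in> \<Y>_atlas"
  shows "(quadrants, \<psi> \<circ> aff_line) \<in> submanifold_atlas quadrants" "\<Y>' \<subseteq> B"
proof -
  consider (1) "B = range (\<lambda>(s, t). line (Y_mat 1 s t))" "\<psi> = inv_into UNIV (\<lambda>(s, t). line (Y_mat 1 s t))"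
    | (2) "B = range (\<lambda>(s, t). line (Y_mat s 1 t))" "\<psi> = inv_into UNIV (\<lambda>(s, t). line (Y_mat s 1 t))"
    | (3) "B = range (\<lambda>(s, t). line (Y_mat s t 1))" "\<psi> = inv_into UNIV (\<lambda>(s, t). line (Y_mat s t 1))"
    using assms by (auto simp: \<Y>_atlas_def)
  then have "(quadrants, \<psi> \<circ> aff_line) \<in> submanifold_atlas quadrants \<and> \<Y>' \<subseteq> B"
  proof cases
    case 1
    have "(quadrants, \<psi> \<circ> aff_line) \<in> submanifold_atlas quadrants"
      by (rule submanifold_atlasI[OF _ open_quadrants _ smooth_on_ident])
        (auto simp: 1 aff_chart_1 intro: smooth_on_cong[OF smooth_on_ident])
    moreover have "aff_line p \<in> B" for p
      unfolding 1 by (rule range_eqI[of _ _ p]) (simp add: aff_line_def split_beta)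
    ultimately show ?thesis by (auto simp: \<Y>'_eq)
  next
    case 2
    let ?f = "\<lambda>p. (inverse (fst p), snd p * inverse (fst p))"
    have sm: "smooth_on quadrants ?f"
      by (intro smooth_on_intros) (auto simp: quadrants_def)
    have "(quadrants, \<psi> \<circ> aff_line) \<in> submanifold_atlas quadrants"
    proof (rule submanifold_atlasI[OF _ open_quadrants _ sm])
      show "smooth_on quadrants (\<psi> \<circ> aff_line)"
        by (rule smooth_on_cong[OF sm]) (simp add: 2 aff_chart_2 divide_inverse)
    qed (auto simp: 2 aff_chart_2 quadrants_def field_simps)
    moreover have "aff_line p \<in> B" if "p \<in> quadrants" for p
      unfolding 2 by (rule range_eqI[of _ _ "(1 / fst p, snd p / fst p)"], rule sym)
        (use that in \<open>simp add: line_eq_aff_line quadrants_def prod_eq_iff\<close>)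
    ultimately show ?thesis by (auto simp: \<Y>'_eq)
  next
    case 3
    let ?f = "\<lambda>p. (inverse (snd p), fst p * inverse (snd p))"
    let ?g = "\<lambda>p. (snd p * inverse (fst p), inverse (fst p))"
    have sm: "smooth_on quadrants ?f" "smooth_on quadrants ?g"
      by (intro smooth_on_intros; auto simp: quadrants_def)+
    have "(quadrants, \<psi> \<circ> aff_line) \<in> submanifold_atlas quadrants"
    proof (rule submanifold_atlasI[OF _ open_quadrants _ sm(2)])
      show "smooth_on quadrants (\<psi> \<circ> aff_line)"
        by (rule smooth_on_cong[OF sm(1)]) (simp add: 3 aff_chart_3 divide_inverse)
    qed (auto simp: 3 aff_chart_3 quadrants_def field_simps)
    moreover have "aff_line p \<in> B" if "p \<in> quadrants" for p
      unfolding 3 by (rule range_eqI[of _ _ "(1 / snd p, fst p / snd p)"], rule sym)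
        (use that in \<open>simp add: line_eq_aff_line quadrants_def prod_eq_iff\<close>)
    ultimately show ?thesis by (auto simp: \<Y>'_eq)
  qed
  then show "(quadrants, \<psi> \<circ> aff_line) \<in> submanifold_atlas quadrants" "\<Y>' \<subseteq> B" by auto
qed

section \<open>The group of order eight\<close>

text \<open>The elements of \<open>N0\<close> are the signed permutation matrices that preserve the third axis; the determinant
  condition fixes the third diagonal entry. They form a dihedral group.\<close>

definition diag_rot :: "real \<Rightarrow> real \<Rightarrow> mat3" where
  "diag_rot a b = vector [vector [a, 0, 0], vector [0, b, 0], vector [0, 0, a * b]]"

definition swap_rot :: "real \<Rightarrow> real \<Rightarrow> mat3" where
  "swap_rot a b = vector [vector [0, a, 0], vector [b, 0, 0], vector [0, 0, - (a * b)]]"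

definition signed_rots :: "mat3 set" where
  "signed_rots = {diag_rot 1 1, diag_rot 1 (-1), diag_rot (-1) 1, diag_rot (-1) (-1),
     swap_rot 1 1, swap_rot 1 (-1), swap_rot (-1) 1, swap_rot (-1) (-1)}"

lemma signed_rots_SO3: "signed_rots \<subseteq> SO3"
  by (auto simp: signed_rots_def SO3_iff diag_rot_def swap_rot_def mat3_simps det_3)

lemma signed_rots_mult: "m \<in> signed_rots \<Longrightarrow> n \<in> signed_rots \<Longrightarrow> m ** n \<in> signed_rots"
proof -
  have "diag_rot a b ** diag_rot c d = diag_rot (a * c) (b * d)"
    "diag_rot a b ** swap_rot c d = swap_rot (a * c) (b * d)"
    "swap_rot a b ** diag_rot c d = swap_rot (a * d) (b * c)"
    "swap_rot a b ** swap_rot c d = diag_rot (a * d) (b * c)" for a b c d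
    by (simp_all add: diag_rot_def swap_rot_def mat3_simps)
  then show "m \<in> signed_rots \<Longrightarrow> n \<in> signed_rots \<Longrightarrow> m ** n \<in> signed_rots"
    unfolding signed_rots_def by (elim insertE emptyE) simp_all
qed

lemma signed_rots_transpose: "n \<in> signed_rots \<Longrightarrow> transpose n \<in> signed_rots"
proof -
  have "transpose (diag_rot a b) = diag_rot a b" "transpose (swap_rot a b) = swap_rot b a" for a b
    by (simp_all add: diag_rot_def swap_rot_def mat3_simps)
  then show "n \<in> signed_rots \<Longrightarrow> transpose n \<in> signed_rots"
    unfolding signed_rots_def by (elim insertE emptyE) simp_all
qed

lemma N0_eq_signed_rots: "N0 = signed_rots"
proof (intro equalityI subsetI)
  have gens: "s0 = swap_rot 1 (-1)" "m2 = diag_rot 1 (-1)" "mat 1 = diag_rot 1 1"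
    by (simp_all add: s0_def m2_def diag_rot_def swap_rot_def mat3_simps)
  {
    fix n assume "n \<in> N0"
    then show "n \<in> signed_rots"
      unfolding N0_def
    proof (induction rule: generate.induct)
      case one
      then show ?case by (simp add: SO3_group_def gens signed_rots_def)
    next
      case (incl h)
      then show ?case by (auto simp: gens signed_rots_def)
    next
      case (inv h)
      then have "h \<in> signed_rots" by (auto simp: gens signed_rots_def)
      then show ?case using signed_rots_SO3 signed_rots_transpose by (auto simp: inv_SO3_group)
    next
      case (eng h1 h2)
      then show ?case by (simp add: SO3_group_def signed_rots_mult)
    qed
  }
  have mult: "m ** n \<in> N0" if "m \<in> N0" "n \<in> N0" for m n
    using generate.eng[of m SO3_group "{s0, m2}" n] that by (simp add: N0_def SO3_group_def)
  have s: "s0 \<in> N0" "m2 \<in> N0" by (auto simp: N0_def intro: generate.incl)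
  have eqs: "diag_rot 1 1 = m2 ** m2" "diag_rot 1 (-1) = m2" "diag_rot (-1) (-1) = s0 ** s0"
    "diag_rot (-1) 1 = s0 ** s0 ** m2" "swap_rot 1 (-1) = s0" "swap_rot (-1) 1 = s0 ** s0 ** s0"
    "swap_rot 1 1 = m2 ** s0" "swap_rot (-1) (-1) = s0 ** m2"
    by (simp_all add: s0_def m2_def diag_rot_def swap_rot_def mat3_simps)
  show "n \<in> N0" if "n \<in> signed_rots" for n
    using that unfolding signed_rots_def eqs using s mult by blast
qed

lemma N0_SO3: "n \<in> N0 \<Longrightarrow> n \<in> SO3"
  using signed_rots_SO3 by (auto simp: N0_eq_signed_rots)

lemma finite_N0: "finite N0"
  by (simp add: N0_eq_signed_rots signed_rots_def)

text \<open>Orthogonality of rows and columns spreads the given zeros until a signed permutation matrix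
  remains, and the cofactor identity determines the sign of the last diagonal entry.\<close>

lemma SO3_signed_rot:
  assumes k: "k \<in> SO3" and z: "k$1$3 = 0" "k$2$3 = 0" "k$1$1 = 0 \<or> k$1$2 = 0"
  shows "k \<in> N0"
proof -
  note e = SO3_rows[OF k] SO3_columns[OF k] SO3_cofactors[OF k]
  have sq: "x = 1 \<or> x = -1" if "x * x = 1" for x :: real
    using that by (simp add: square_eq_1_iff)
  have "k$3$3 * k$3$3 = 1" using e(9) z by simp
  then have "k$3$3 \<noteq> 0" by auto
  then have z3: "k$3$1 = 0" "k$3$2 = 0" using e(11,12) z by simp_all
  from z(3) show ?thesis
  proof
    assume 1: "k$1$1 = 0"
    then have a: "k$1$2 * k$1$2 = 1" using e(1) z by simp
    then have 2: "k$2$2 = 0" using e(4) z 1 by auto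
    then have b: "k$2$1 * k$2$1 = 1" using e(2) z by simp
    have "k$3$3 = - (k$1$2 * k$2$1)" using e(15) 1 by simp
    then have "k = swap_rot (k$1$2) (k$2$1)"
      by (simp add: swap_rot_def vec_eq_iff forall_3 z z3 1 2)
    then show ?thesis
      using sq[OF a] sq[OF b] unfolding N0_eq_signed_rots signed_rots_def
      by (elim disjE; simp (no_asm_simp) only: insert_iff; simp)
  next
    assume 1: "k$1$2 = 0"
    then have a: "k$1$1 * k$1$1 = 1" using e(1) z by simp
    then have 2: "k$2$1 = 0" using e(4) z 1 by auto
    then have b: "k$2$2 * k$2$2 = 1" using e(2) z by simp
    have "k$3$3 = k$1$1 * k$2$2" using e(15) 1 by simp
    then have "k = diag_rot (k$1$1) (k$2$2)"
      by (simp add: diag_rot_def vec_eq_iff forall_3 z z3 1 2)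
    then show ?thesis
      using sq[OF a] sq[OF b] unfolding N0_eq_signed_rots signed_rots_def
      by (elim disjE; simp (no_asm_simp) only: insert_iff; simp)
  qed
qed

text \<open>The action of \<open>N0\<close> on lines, in affine coordinates. A conjugate of \<open>Y_aff p\<close> is again of the form
  \<open>Y_mat\<close>, with first entry \<open>n$1$1\<^sup>2 - n$1$2\<^sup>2 = \<plusminus>1\<close>, by which the other two are divided.\<close>

definition aff_act :: "mat3 \<Rightarrow> real \<times> real \<Rightarrow> real \<times> real" where
  "aff_act n p =
     ((n$1$1 * n$1$1 + (-1) * (n$1$2 * n$1$2)) * n$3$3 * (n$1$1 * fst p + n$1$2 * snd p),
      (n$1$1 * n$1$1 + (-1) * (n$1$2 * n$1$2)) * n$3$3 * (n$2$1 * fst p + n$2$2 * snd p))"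

lemma N0_cases:
  assumes "n \<in> N0"
  obtains a b where "a = 1 \<or> a = -1" "b = 1 \<or> b = -1" "n = diag_rot a b"
  | a b where "a = 1 \<or> a = -1" "b = 1 \<or> b = -1" "n = swap_rot a b"
  using assms unfolding N0_eq_signed_rots signed_rots_def by blast

lemma diag_rot_entries:
  "diag_rot a b$1$1 = a" "diag_rot a b$2$2 = b" "diag_rot a b$3$3 = a * b" "diag_rot a b$1$2 = 0"
  "diag_rot a b$2$1 = 0" "diag_rot a b$1$3 = 0" "diag_rot a b$3$1 = 0" "diag_rot a b$2$3 = 0"
  "diag_rot a b$3$2 = 0"
  by (simp_all add: diag_rot_def)

lemma swap_rot_entries:
  "swap_rot a b$1$2 = a" "swap_rot a b$2$1 = b" "swap_rot a b$3$3 = - (a * b)" "swap_rot a b$1$1 = 0"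
  "swap_rot a b$2$2 = 0" "swap_rot a b$1$3 = 0" "swap_rot a b$3$1 = 0" "swap_rot a b$2$3 = 0"
  "swap_rot a b$3$2 = 0"
  by (simp_all add: swap_rot_def)

lemma conj_mat_X0_N0:
  assumes "n \<in> N0" shows "conj_mat n X0 = X0"
  unfolding conj_mat_SO3[OF N0_SO3[OF assms]] using assms
  by (cases rule: N0_cases)
    (auto simp: mat3_simps X0_entries diag_rot_entries swap_rot_entries)

lemma aff_act_N0:
  assumes "n \<in> N0"
  shows "p \<in> quadrants \<Longrightarrow> aff_act n p \<in> quadrants"
    and "conj_set n (aff_line p) = aff_line (aff_act n p)"
proof -
  define c where "c = n$1$1 * n$1$1 - n$1$2 * n$1$2"
  have "conj_mat n (Y_aff p) = c *\<^sub>R Y_aff (aff_act n p) \<and> c \<noteq> 0 \<and>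
      (p \<in> quadrants \<longrightarrow> aff_act n p \<in> quadrants)"
    unfolding conj_mat_SO3[OF N0_SO3[OF assms]] c_def using assms
    by (cases rule: N0_cases; elim disjE;
        simp add: mat3_simps Y_mat_entries diag_rot_entries swap_rot_entries aff_act_def quadrants_def)
  then show "p \<in> quadrants \<Longrightarrow> aff_act n p \<in> quadrants"
    "conj_set n (aff_line p) = aff_line (aff_act n p)"
    using line_scaleR[of c "Y_aff (aff_act n p)"]
    by (auto simp: aff_line_def line_def conj_set_span)
qed

lemma aff_act_1: "aff_act (mat 1) p = p"
  by (simp add: aff_act_def mat_def)

section \<open>Conjugate planes\<close>

text \<open>\<open>W_of\<close> as a function of the line instead of a matrix spanning it.\<close>

definition plane_of :: "mat3 set \<Rightarrow> mat3 set" where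
  "plane_of L = span (insert X0 L)"

lemma plane_of_line: "plane_of (line Y) = W_of Y"
proof -
  have "insert X0 (span {Y}) \<subseteq> span {X0, Y}"
    using span_mono[of "{Y}" "{X0, Y}"] by (auto simp: span_base)
  moreover have "{X0, Y} \<subseteq> insert X0 (span {Y})" by (auto simp: span_base)
  then have "{X0, Y} \<subseteq> span (insert X0 (span {Y}))" using span_superset by blast
  ultimately have "span (insert X0 (span {Y})) = span {X0, Y}" by (simp add: span_eq)
  then show ?thesis by (simp add: plane_of_def line_def W_of_def)
qed

lemma conj_set_plane_of: "conj_set k (plane_of L) = span (insert (conj_mat k X0) (conj_set k L))"
  unfolding plane_of_def conj_set_span by (simp add: conj_set_def)

lemma conj_set_plane_of_N0: "n \<in> N0 \<Longrightarrow> conj_set n (plane_of L) = plane_of (conj_set n L)"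
  unfolding conj_set_plane_of by (simp add: conj_mat_X0_N0 plane_of_def)

lemma mem_W_of: "Z \<in> W_of Y \<longleftrightarrow> (\<exists>a b. Z = a *\<^sub>R X0 + b *\<^sub>R Y)"
proof -
  have "Z \<in> W_of Y \<longleftrightarrow> (\<exists>a b. Z - a *\<^sub>R X0 = b *\<^sub>R Y)"
    by (auto simp: W_of_def span_breakdown_eq span_singleton)
  then show ?thesis by (simp add: diff_eq_eq add.commute)
qed

text \<open>Writing \<open>X0 = 1 - 3 e e\<^sup>T\<close> with the third basis vector \<open>e\<close>, a conjugate of \<open>X0\<close> is \<open>1 - 3 v v\<^sup>T\<close>
  with \<open>v = k e\<close>. If it is \<open>a X0 + b Y_aff q\<close>, its entry \<open>(1,2)\<close> vanishes, hence \<open>v$1\<close> or \<open>v$2\<close> does, and with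
  it one of the entries \<open>(1,3)\<close> and \<open>(2,3)\<close>. These are \<open>b\<close> times the coordinates of \<open>q\<close>, which are not zero; so
  \<open>b = 0\<close>, and then \<open>v = \<plusminus>e\<close>. The rotation therefore preserves the splitting into the first two axes and the
  third. It must carry the upper block \<open>diag(1, -1)\<close> of \<open>Y_aff p\<close> to a diagonal matrix, and since this block has distinct
  eigenvalues, it permutes the first two axes.\<close>

lemma conj_plane_eq_imp_N0:
  assumes k: "k \<in> SO3" and p: "p \<in> quadrants" and q: "q \<in> quadrants"
    and eq: "conj_set k (plane_of (aff_line p)) = plane_of (aff_line q)"
  shows "k \<in> N0" and "aff_act k p = q"
proof -
  note e = SO3_rows[OF k] SO3_columns[OF k]
  have W: "conj_mat k Z \<in> W_of (Y_aff q)" if "Z \<in> W_of (Y_aff p)" for Z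
    using eq that by (auto simp: conj_set_def aff_line_def plane_of_line)
  have "conj_mat k X0 \<in> W_of (Y_aff q)"
    by (rule W) (simp add: W_of_def span_base)
  then obtain a b where "conj_mat k X0 = a *\<^sub>R X0 + b *\<^sub>R Y_aff q" unfolding mem_W_of by blast
  then have ab: "conj_mat k X0 $ i $ j = a * X0 $ i $ j + b * Y_aff q $ i $ j" for i j by simp
  have entry: "conj_mat k X0 $ i $ j = k$i$1*k$j$1 + k$i$2*k$j$2 - 2*(k$i$3*k$j$3)" for i j
    by (simp add: conj_mat_SO3[OF k] matrix_matrix_mult_def transpose_def sum_3 X0_entries)
  note ab' = ab[unfolded entry]
  \<comment> \<open>The third column of \<open>k\<close> is the vector \<open>v\<close>.\<close>
  have 12: "k$1$3 * k$2$3 = 0" using ab'[of 1 2] e(4) by (simp add: X0_entries Y_mat_entries)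
  have 13: "- 3 * (k$1$3 * k$3$3) = b * fst q"
    using ab'[of 1 3] e(5) by (simp add: X0_entries Y_mat_entries)
  have 23: "- 3 * (k$2$3 * k$3$3) = b * snd q"
    using ab'[of 2 3] e(6) by (simp add: X0_entries Y_mat_entries)
  have b: "b = 0" using 12 13 23 q by (auto simp: quadrants_def)
  have "1 - 3 * (k$1$3 * k$1$3) = a" "1 - 3 * (k$2$3 * k$2$3) = a"
    using ab'[of 1 1] ab'[of 2 2] e(1,2) by (simp_all add: X0_entries Y_mat_entries b)
  then have "k$1$3 * k$1$3 = k$2$3 * k$2$3" by simp
  then have z: "k$1$3 = 0" "k$2$3 = 0" using 12 by auto
  have "k$3$3 * k$3$3 = 1" using e(9) z by simp
  then have "k$3$3 \<noteq> 0" by auto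
  then have z3: "k$3$1 = 0" "k$3$2 = 0" using e(11,12) z by simp_all
  have "conj_mat k (Y_aff p) \<in> W_of (Y_aff q)"
    by (rule W) (simp add: W_of_def span_base)
  then obtain c d where "conj_mat k (Y_aff p) = c *\<^sub>R X0 + d *\<^sub>R Y_aff q" unfolding mem_W_of by blast
  then have cd: "conj_mat k (Y_aff p) $ i $ j = c * X0 $ i $ j + d * Y_aff q $ i $ j" for i j by simp
  \<comment> \<open>With the orthogonality of the first two rows, both products vanish separately.\<close>
  have "k$1$1 * k$2$1 - k$1$2 * k$2$2 = 0"
    using cd[of 1 2] by (simp add: conj_mat_SO3[OF k] matrix_matrix_mult_def transpose_def sum_3
        X0_entries Y_mat_entries z z3 algebra_simps)
  then have "k$1$1 * k$2$1 = 0" "k$1$2 * k$2$2 = 0" using e(4) z by simp_all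
  then have "k$1$1 = 0 \<or> k$1$2 = 0" using e(2) z by auto
  then show N: "k \<in> N0" by (rule SO3_signed_rot[OF k z])
  have "plane_of (aff_line (aff_act k p)) = plane_of (aff_line q)"
    unfolding aff_act_N0(2)[OF N, symmetric] conj_set_plane_of_N0[OF N, symmetric] by (rule eq)
  then have "W_of (Y_aff (aff_act k p)) = W_of (Y_aff q)"
    unfolding aff_line_def plane_of_line .
  then have "Y_aff (aff_act k p) \<in> W_of (Y_aff q)"
    unfolding W_of_def using span_base[of "Y_aff (aff_act k p)" "{X0, Y_aff (aff_act k p)}"] by simp
  then obtain r s where "Y_aff (aff_act k p) = r *\<^sub>R X0 + s *\<^sub>R Y_aff q" unfolding mem_W_of by blast
  then have rs: "Y_aff (aff_act k p) $ i $ j = r * X0 $ i $ j + s * Y_aff q $ i $ j" for i j by simp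
  have "r = 0" using rs[of 3 3] by (simp add: X0_entries Y_mat_entries)
  moreover from this have "s = 1" using rs[of 1 1] by (simp add: X0_entries Y_mat_entries)
  ultimately show "aff_act k p = q"
    using rs[of 1 3] rs[of 2 3] by (simp add: X0_entries Y_mat_entries prod_eq_iff)
qed

text \<open>The map \<open>(k, [Y]) \<mapsto> k \<cdot> W_Y\<close> and the action \<open>(k, [Y]) \<mapsto> (k n\<^sup>-\<^sup>1, n \<cdot> [Y])\<close> of \<open>N0\<close>, in affine
  coordinates; the next lemma says that the orbits of the action are the fibres of the map.\<close>

definition conj_plane :: "mat3 \<times> (real \<times> real) \<Rightarrow> mat3 set" where
  "conj_plane u = conj_set (fst u) (plane_of (aff_line (snd u)))"

definition deck :: "mat3 \<Rightarrow> mat3 \<times> (real \<times> real) \<Rightarrow> mat3 \<times> (real \<times> real)" where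
  "deck n u = (fst u ** transpose n, aff_act n (snd u))"

lemma conj_plane_eq_iff:
  assumes u: "u \<in> SO3 \<times> quadrants" and v: "v \<in> SO3 \<times> quadrants"
  shows "conj_plane u = conj_plane v \<longleftrightarrow> (\<exists>n\<in>N0. v = deck n u)"
proof
  obtain k p l q where uv: "u = (k, p)" "v = (l, q)" "k \<in> SO3" "l \<in> SO3" "p \<in> quadrants"
    "q \<in> quadrants"
    using u v by auto
  assume eq: "conj_plane u = conj_plane v"
  let ?n = "transpose l ** k"
  have n: "?n \<in> SO3" using uv by (simp add: SO3_mult SO3_transpose)
  have "conj_set ?n (plane_of (aff_line p)) = plane_of (aff_line q)"
    using eq uv by (simp add: conj_plane_def conj_set_mult SO3_transpose conj_set_cancel)
  from conj_plane_eq_imp_N0[OF n uv(5,6) this] have "?n \<in> N0" "aff_act ?n p = q" .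
  moreover have "k ** transpose ?n = l"
    by (simp add: matrix_transpose_mul matrix_mul_assoc SO3_mult_transpose uv)
  ultimately show "\<exists>n\<in>N0. v = deck n u" using uv by (intro bexI[of _ ?n]) (simp_all add: deck_def)
next
  assume "\<exists>n\<in>N0. v = deck n u"
  then obtain n where n: "n \<in> N0" "v = deck n u" by blast
  have "conj_plane v = conj_set (fst u ** transpose n ** n) (plane_of (aff_line (snd u)))"
    using n u by (simp add: conj_plane_def deck_def aff_act_N0(2)[symmetric] N0_SO3 SO3_mult
        SO3_transpose conj_set_mult conj_set_plane_of_N0 mem_Times_iff)
  then show "conj_plane u = conj_plane v"
    using n by (simp add: conj_plane_def SO3_cancel N0_SO3)
qed

interpretation slice: finite_smooth_quotient "SO3 \<times> quadrants" N0 deck conj_plane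
proof
  show "smooth_on (SO3 \<times> quadrants) (deck n)" for n
    unfolding deck_def[abs_def] aff_act_def by (intro smooth_on_intros)
  show "deck n u \<in> SO3 \<times> quadrants" if "n \<in> N0" "u \<in> SO3 \<times> quadrants" for n u
    using that by (auto simp: deck_def SO3_mult SO3_transpose N0_SO3 aff_act_N0)
  show "deck n v = v" if "n \<in> N0" "u \<in> SO3 \<times> quadrants" "deck n u = u" for n u v
  proof -
    have "fst u ** transpose n = fst u" using that by (auto simp: deck_def prod_eq_iff)
    then have "transpose (fst u) ** (fst u ** transpose n) = mat 1"
      using that SO3_mult_transpose[of "fst u"] by (auto simp: mem_Times_iff)
    then have "transpose n = mat 1" using that by (simp add: SO3_cancel mem_Times_iff)
    then have "n = mat 1" by (metis transpose_mat transpose_transpose)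
    then show ?thesis by (simp add: deck_def transpose_mat aff_act_1)
  qed
qed (use finite_N0 conj_plane_eq_iff in auto)

section \<open>The twisted product\<close>

definition orbit_plane :: "mat3 \<times> mat3 set \<Rightarrow> mat3 set" where
  "orbit_plane x = conj_set (fst x) (plane_of (snd x))"

definition twist_proj :: "mat3 \<times> mat3 set \<Rightarrow> (mat3 \<times> mat3 set) set" where
  "twist_proj = (\<lambda>(k, L). twist_class k L)"

definition slice_lift :: "mat3 \<times> (real \<times> real) \<Rightarrow> mat3 \<times> mat3 set" where
  "slice_lift u = (fst u, aff_line (snd u))"

lemma orbit_plane_slice_lift: "orbit_plane (slice_lift u) = conj_plane u"
  by (simp add: orbit_plane_def slice_lift_def conj_plane_def)

lemma slice_lift_image: "slice_lift ` (SO3 \<times> quadrants) = SO3 \<times> \<Y>'"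
  by (force simp: slice_lift_def \<Y>'_eq image_iff)

lemma inj_slice_lift: "inj slice_lift"
  using inj_aff_line by (auto simp: slice_lift_def inj_def prod_eq_iff)

text \<open>This is the description of the fibres of \<open>conj_plane\<close> in terms of lines. As the kernel of a map, \<open>twist_rel\<close> is
  an equivalence relation, and \<open>twist_map\<close> is well defined and injective.\<close>

lemma twist_rel_eq:
  "twist_rel = {(x, y). x \<in> SO3 \<times> \<Y>' \<and> y \<in> SO3 \<times> \<Y>' \<and> orbit_plane x = orbit_plane y}"
proof (intro equalityI subsetI)
  fix z assume "z \<in> twist_rel"
  then obtain k n L where z: "z = ((k ** n, L), (k, conj_set n L))" and
    *: "k \<in> SO3" "n \<in> N0" "L \<in> \<Y>'"
    unfolding twist_rel_def by blast
  then have "conj_set n L \<in> \<Y>'" by (auto simp: \<Y>'_eq aff_act_N0)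
  then show "z \<in> {(x, y). x \<in> SO3 \<times> \<Y>' \<and> y \<in> SO3 \<times> \<Y>' \<and> orbit_plane x = orbit_plane y}"
    using * by (simp add: z SO3_mult N0_SO3 orbit_plane_def conj_set_mult conj_set_plane_of_N0)
next
  fix z assume "z \<in> {(x, y). x \<in> SO3 \<times> \<Y>' \<and> y \<in> SO3 \<times> \<Y>' \<and> orbit_plane x = orbit_plane y}"
  then obtain u v where uv: "z = (slice_lift u, slice_lift v)" "u \<in> SO3 \<times> quadrants"
    "v \<in> SO3 \<times> quadrants" "conj_plane u = conj_plane v"
    by (auto simp: slice_lift_image[symmetric] orbit_plane_slice_lift)
  then obtain n where n: "n \<in> N0" "v = deck n u" using conj_plane_eq_iff by blast
  have "fst u = fst v ** n" "conj_set n (aff_line (snd u)) = aff_line (snd v)"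
    using n by (simp_all add: deck_def SO3_cancel N0_SO3 aff_act_N0)
  then have "z = ((fst v ** n, aff_line (snd u)), (fst v, conj_set n (aff_line (snd u))))"
    by (simp add: uv(1) slice_lift_def)
  then show "z \<in> twist_rel"
    unfolding twist_rel_def using uv n(1) by (auto simp: \<Y>'_eq)
qed

lemma twist_class_eq:
  assumes "k \<in> SO3" "L \<in> \<Y>'"
  shows "twist_class k L = {y \<in> SO3 \<times> \<Y>'. orbit_plane y = orbit_plane (k, L)}"
  using assms by (auto simp: twist_class_def twist_rel_eq)

lemma twist_class_eq_iff:
  assumes "k \<in> SO3" "L \<in> \<Y>'" "l \<in> SO3" "M \<in> \<Y>'"
  shows "twist_class k L = twist_class l M \<longleftrightarrow> orbit_plane (k, L) = orbit_plane (l, M)"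
  unfolding twist_class_eq[OF assms(1,2)] twist_class_eq[OF assms(3,4)] using assms by blast

lemma twist_prod_eq: "twist_prod = twist_proj ` (SO3 \<times> \<Y>')"
  by (auto simp: twist_prod_def quotient_def twist_proj_def twist_class_def)

lemma \<Y>'_line:
  assumes "L \<in> \<Y>'" obtains Y where "L = line Y"
  using assms by (auto simp: \<Y>'_def)

lemma twist_map_class:
  assumes "k \<in> SO3" "L \<in> \<Y>'"
  shows "twist_map (twist_class k L) = orbit_plane (k, L)"
  unfolding twist_map_def
proof (rule the_equality)
  obtain Y where Y: "L = line Y" using assms(2) by (rule \<Y>'_line)
  show "\<exists>l\<in>SO3. \<exists>Y. line Y \<in> \<Y>' \<and> twist_class k L = twist_class l (line Y) \<and>
      orbit_plane (k, L) = conj_set l (W_of Y)"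
    using assms by (intro bexI[of _ k] exI[of _ Y]) (auto simp: Y orbit_plane_def plane_of_line)
next
  fix W assume "\<exists>l\<in>SO3. \<exists>Y. line Y \<in> \<Y>' \<and> twist_class k L = twist_class l (line Y) \<and>
      W = conj_set l (W_of Y)"
  then obtain l Y where "l \<in> SO3" "line Y \<in> \<Y>'" "twist_class k L = twist_class l (line Y)"
    "W = conj_set l (W_of Y)" by blast
  then show "W = orbit_plane (k, L)"
    using assms by (simp add: twist_class_eq_iff) (simp add: orbit_plane_def plane_of_line)
qed

lemma twist_map_proj: "x \<in> SO3 \<times> \<Y>' \<Longrightarrow> twist_map (twist_proj x) = orbit_plane x"
  by (auto simp: twist_proj_def twist_map_class)

lemma \<X>'_eq: "\<X>' = orbit_plane ` (SO3 \<times> \<Y>')"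
proof (intro equalityI subsetI)
  fix W assume "W \<in> \<X>'"
  then obtain k Y where "W = orbit_plane (k, line Y)" "k \<in> SO3" "line Y \<in> \<Y>'"
    by (auto simp: \<X>'_def orbit_plane_def plane_of_line)
  then show "W \<in> orbit_plane ` (SO3 \<times> \<Y>')" by blast
next
  fix W assume "W \<in> orbit_plane ` (SO3 \<times> \<Y>')"
  then obtain k L where kL: "W = orbit_plane (k, L)" "k \<in> SO3" "L \<in> \<Y>'" by auto
  moreover obtain Y where "L = line Y" using kL(3) by (rule \<Y>'_line)
  ultimately show "W \<in> \<X>'" by (auto simp: \<X>'_def orbit_plane_def plane_of_line)
qed

lemma bij_betw_twist_map: "bij_betw twist_map twist_prod \<X>'"
proof (rule bij_betw_imageI)
  show "inj_on twist_map twist_prod"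
  proof (rule inj_onI)
    fix c d assume cd: "c \<in> twist_prod" "d \<in> twist_prod" "twist_map c = twist_map d"
    then obtain k L l M where "k \<in> SO3" "L \<in> \<Y>'" "l \<in> SO3" "M \<in> \<Y>'"
      "c = twist_class k L" "d = twist_class l M"
      by (auto simp: twist_prod_eq twist_proj_def)
    then show "c = d" using cd(3) by (simp add: twist_map_class twist_class_eq_iff)
  qed
  show "twist_map ` twist_prod = \<X>'"
    unfolding twist_prod_eq \<X>'_eq image_image by (rule image_cong) (simp_all add: twist_map_proj)
qed

lemma orbit_plane_mult:
  "k \<in> SO3 \<Longrightarrow> l \<in> SO3 \<Longrightarrow> orbit_plane (k ** l, L) = conj_set k (orbit_plane (l, L))"
  by (simp add: orbit_plane_def conj_set_mult)

text \<open>Translating a class by \<open>k\<close> gives a whole class, and not just a part of one, since translation by the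
  inverse of \<open>k\<close> brings it back.\<close>

lemma twist_act_class:
  assumes "k \<in> SO3" "l \<in> SO3" "L \<in> \<Y>'"
  shows "twist_act k (twist_class l L) = twist_class (k ** l) L"
proof (intro equalityI subsetI)
  fix z assume "z \<in> twist_act k (twist_class l L)"
  then obtain m M where z: "z = (k ** m, M)" "m \<in> SO3" "M \<in> \<Y>'"
    "orbit_plane (m, M) = orbit_plane (l, L)"
    using assms by (auto simp: twist_act_def twist_class_eq)
  then show "z \<in> twist_class (k ** l) L"
    using assms by (simp add: twist_class_eq SO3_mult orbit_plane_mult)
next
  fix z assume "z \<in> twist_class (k ** l) L"
  then obtain m M where z: "z = (m, M)" "m \<in> SO3" "M \<in> \<Y>'"
    "orbit_plane (m, M) = orbit_plane (k ** l, L)"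
    using assms by (auto simp: twist_class_eq SO3_mult)
  have "orbit_plane (transpose k ** m, M) = orbit_plane (l, L)"
    using assms z by (simp add: orbit_plane_mult SO3_transpose conj_set_cancel)
  then have "(transpose k ** m, M) \<in> twist_class l L"
    using assms z by (simp add: twist_class_eq SO3_mult SO3_transpose)
  then show "z \<in> twist_act k (twist_class l L)"
    unfolding twist_act_def by (rule rev_image_eqI) (simp add: z(1) SO3_cancel assms(1))
qed

section \<open>Topology and charts of the twisted product\<close>

lemma homeomorphic_map_slice_lift:
  "homeomorphic_map (top_of_set (SO3 \<times> quadrants)) pre_twist_topology slice_lift"
proof -
  obtain g where g: "homeomorphic_maps (top_of_set quadrants) (subtopology \<Y>_topology \<Y>') aff_line g"
    using homeomorphic_map_aff_line unfolding homeomorphic_map_maps by blast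
  have "homeomorphic_maps (top_of_set SO3) (top_of_set SO3) id id"
    by (simp add: homeomorphic_maps_id)
  with g have "homeomorphic_maps (prod_topology (top_of_set SO3) (top_of_set quadrants))
      pre_twist_topology (\<lambda>(k, p). (id k, aff_line p)) (\<lambda>(k, L). (id k, g L))"
    unfolding pre_twist_topology_def SO3_topology_def homeomorphic_maps_prod by blast
  moreover have "(\<lambda>(k, p). (id k, aff_line p)) = slice_lift"
    by (auto simp: slice_lift_def fun_eq_iff)
  ultimately show ?thesis using homeomorphic_maps_imp_map by force
qed

lemma topspace_pre_twist: "topspace pre_twist_topology = SO3 \<times> \<Y>'"
  using homeomorphic_imp_surjective_map[OF homeomorphic_map_slice_lift]
  by (simp add: slice_lift_image)

lemma twist_topology_eq:
  "twist_topology = quotient_topology (top_of_set (SO3 \<times> quadrants)) (twist_proj \<circ> slice_lift)"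
  unfolding twist_topology_def twist_proj_def[symmetric]
  by (rule quotient_topology_homeomorphic_map[OF homeomorphic_map_slice_lift])

lemma twist_map_proj_slice_lift:
  "u \<in> SO3 \<times> quadrants \<Longrightarrow> twist_map (twist_proj (slice_lift u)) = conj_plane u"
  using slice_lift_image by (subst twist_map_proj) (auto simp: orbit_plane_slice_lift)

lemma quotient_topology_cong:
  assumes "\<And>x. x \<in> topspace T \<Longrightarrow> f x = g x"
  shows "quotient_topology T f = quotient_topology T g"
proof -
  have "f ` topspace T = g ` topspace T" using assms by (rule image_cong[OF refl])
  moreover have "{x \<in> topspace T. f x \<in> V} = {x \<in> topspace T. g x \<in> V}" for V using assms by auto
  ultimately show ?thesis by (simp add: quotient_topology_def)
qed

lemma \<X>'_topology_eq: "\<X>'_topology = slice.T"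
  unfolding \<X>'_topology_def twist_topology_eq quotient_topology_comp
  by (rule quotient_topology_cong) (simp add: twist_map_proj_slice_lift)

lemma conj_plane_image: "conj_plane ` (SO3 \<times> quadrants) = \<X>'"
  unfolding \<X>'_eq slice_lift_image[symmetric] image_image orbit_plane_slice_lift by simp

lemma topspace_\<X>'_topology: "topspace \<X>'_topology = \<X>'"
  by (simp add: \<X>'_topology_eq slice.topspace_T conj_plane_image)

lemma topspace_twist_topology: "topspace twist_topology = twist_prod"
  by (simp only: twist_topology_eq topspace_quotient_topology topspace_euclidean_subtopology
      image_comp[symmetric] slice_lift_image twist_prod_eq)

lemma homeomorphic_map_quotient_topology:
  assumes "inj_on f (topspace T)"
  shows "homeomorphic_map T (quotient_topology T f) f"
  unfolding homeomorphic_map_def quotient_map_def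
  using assms by (auto simp: topspace_quotient_topology openin_quotient_topology)

lemma homeomorphic_map_twist_map: "homeomorphic_map twist_topology \<X>'_topology twist_map"
  unfolding \<X>'_topology_def
  by (rule homeomorphic_map_quotient_topology)
    (use bij_betw_twist_map in \<open>simp add: topspace_twist_topology bij_betw_def\<close>)

text \<open>The conjugates of \<open>X0\<close> and \<open>Y_aff\<close> form a basis depending continuously on the point. Since the
  Grassmannian carries the quotient topology from the space of bases, this gives continuity.\<close>

lemma conj_plane_basis:
  assumes "u \<in> SO3 \<times> quadrants"
  defines "Z \<equiv> conj_mat (fst u) X0" and "Z' \<equiv> conj_mat (fst u) (Y_aff (snd u))"
  shows "Z \<in> \<pp>" "Z' \<in> \<pp>" "Z \<noteq> Z'" "independent {Z, Z'}" "conj_plane u = span {Z, Z'}"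
proof -
  have k: "fst u \<in> SO3" using assms by auto
  have "X0 \<in> \<pp>" "Y_aff (snd u) \<in> \<pp>"
    by (simp_all add: \<pp>_def trace_3 mat3_simps X0_entries Y_mat_entries)
  then show "Z \<in> \<pp>" "Z' \<in> \<pp>" using conj_mat_in_\<pp>[OF k] by (simp_all add: Z_def Z'_def)
  have ne: "X0 \<noteq> Y_aff (snd u)"
    by (auto simp: vec_eq_iff forall_3 X0_entries Y_mat_entries)
  then show "Z \<noteq> Z'" using inj_conj_mat[OF k] by (simp add: Z_def Z'_def inj_eq)
  have "X0 \<notin> span {Y_aff (snd u)}"
    by (auto simp: span_singleton vec_eq_iff forall_3 X0_entries Y_mat_entries)
  moreover have "Y_aff (snd u) \<noteq> 0"
    by (auto simp: vec_eq_iff forall_3 Y_mat_entries)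
  ultimately have "independent {X0, Y_aff (snd u)}"
    using ne by (simp add: independent_insert)
  then have "independent (conj_mat (fst u) ` {X0, Y_aff (snd u)})"
    by (rule linear_independent_injective_image[OF linear_conj_mat _
          inj_on_subset[OF inj_conj_mat[OF k] subset_UNIV]])
  then show "independent {Z, Z'}" by (simp add: Z_def Z'_def)
  have "conj_plane u = span (conj_mat (fst u) ` {X0, Y_aff (snd u)})"
    by (simp only: conj_plane_def aff_line_def plane_of_line W_of_def conj_set_span)
  then show "conj_plane u = span {Z, Z'}" by (simp add: Z_def Z'_def)
qed

lemma continuous_map_conj_plane:
  "continuous_map (top_of_set (SO3 \<times> quadrants)) Gr2_topology conj_plane"
proof -
  let ?P = "SO3 \<times> quadrants"
  let ?B = "{(X, Y). X \<in> \<pp> \<and> Y \<in> \<pp> \<and> X \<noteq> Y \<and> independent {X, Y}}"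
  let ?F = "\<lambda>u. (conj_mat (fst u) X0, conj_mat (fst u) (Y_aff (snd u)))"
  have tr: "bounded_linear (transpose :: mat3 \<Rightarrow> mat3)"
    by (rule bounded_linear_euclideanI) (simp_all add: vec_eq_iff transpose_def)
  have c: "continuous_on ?P (\<lambda>u. fst u ** Z u ** transpose (fst u))" if "continuous_on ?P Z" for Z
    by (intro bounded_bilinear.continuous_on[OF bounded_bilinear_matrix_mult]
        bounded_linear.continuous_on[OF tr] continuous_intros that)
  have "continuous_on ?P (\<lambda>u. (fst u ** X0 ** transpose (fst u),
      fst u ** Y_aff (snd u) ** transpose (fst u)))"
    by (intro continuous_on_Pair c continuous_on_Y_mat continuous_intros)
  then have "continuous_on ?P ?F"
    by (rule continuous_on_eq) (auto simp: conj_mat_SO3)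
  moreover have "?F \<in> ?P \<rightarrow> ?B"
    using conj_plane_basis by blast
  ultimately have "continuous_map (top_of_set ?P) (top_of_set ?B) ?F"
    by (auto simp: continuous_map_in_subtopology)
  from continuous_map_compose[OF this continuous_map_quotient_topology]
  have "continuous_map (top_of_set ?P) Gr2_topology ((\<lambda>(X, Y). span {X, Y}) \<circ> ?F)"
    by (simp add: Gr2_topology_def)
  then show ?thesis
    by (rule continuous_map_eq) (use conj_plane_basis(5) in simp)
qed

lemma continuous_map_twist_map:
  "continuous_map twist_topology (subtopology Gr2_topology \<X>') twist_map"
proof -
  have "continuous_map (top_of_set (SO3 \<times> quadrants)) Gr2_topology
      (\<lambda>u. twist_map ((twist_proj \<circ> slice_lift) u))"
    using continuous_map_conj_plane
    by (rule continuous_map_eq) (simp add: twist_map_proj_slice_lift)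
  then have "continuous_map twist_topology Gr2_topology twist_map"
    unfolding twist_topology_eq by (rule continuous_map_from_quotient_topology)
  then show ?thesis
    using bij_betw_twist_map
    by (auto simp: continuous_map_in_subtopology topspace_twist_topology bij_betw_def)
qed

text \<open>A chart of \<open>\<X>'\<close> arises by restricting a product chart and passing twice through a local inverse; on the
  preimage of its domain it is the product chart in the coordinates of \<open>SO3 \<times> quadrants\<close>.\<close>

lemma \<X>'_chart_lifts:
  assumes "C \<in> \<X>'_atlas"
  shows "\<exists>D. slice.lifts_to C D"
proof -
  obtain U U' \<phi> where C: "C = (twist_map ` U', \<phi> \<circ> inv_into U' twist_map)"
    and U: "(U, \<phi>) \<in> twist_atlas" "U' \<subseteq> U" "openin twist_topology U'" "inj_on twist_map U'"
    using assms unfolding \<X>'_atlas_def pushforward_atlas_def by blast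
  obtain A A' \<phi>0 where A: "U = twist_proj ` A'" "\<phi> = \<phi>0 \<circ> inv_into A' twist_proj"
    "(A, \<phi>0) \<in> prod_atlas SO3_atlas (restrict_atlas \<Y>_atlas \<Y>')" "A' \<subseteq> A"
    "openin pre_twist_topology A'" "inj_on twist_proj A'"
    using U(1) unfolding twist_atlas_def pushforward_atlas_def twist_proj_def[symmetric] by blast
  obtain A1 \<phi>1 B \<psi> where A1: "A = A1 \<times> (B \<inter> \<Y>')" "\<phi>0 = map_prod \<phi>1 \<psi>" "(A1, \<phi>1) \<in> SO3_atlas"
    "(B, \<psi>) \<in> \<Y>_atlas"
    using A(3) unfolding prod_atlas_def restrict_atlas_def by blast
  let ?P = "SO3 \<times> quadrants"
  define N where "N = {u \<in> ?P. slice_lift u \<in> A'} \<inter> {u \<in> ?P. (twist_proj \<circ> slice_lift) u \<in> U'}"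
  let ?c = "map_prod \<phi>1 (\<psi> \<circ> aff_line)"
  have "openin (top_of_set ?P) {u \<in> ?P. slice_lift u \<in> A'}"
    using openin_continuous_map_preimage[OF homeomorphic_imp_continuous_map[OF
          homeomorphic_map_slice_lift] A(5)] by simp
  moreover have "openin (top_of_set ?P) {u \<in> ?P. (twist_proj \<circ> slice_lift) u \<in> U'}"
    using U(3) by (simp add: twist_topology_eq openin_quotient_topology)
  ultimately have N: "openin (top_of_set ?P) N" unfolding N_def by (rule openin_Int)
  have NP: "N \<subseteq> ?P" by (auto simp: N_def)
  have "(A1 \<times> quadrants, ?c) \<in> submanifold_atlas ?P"
    using A1(3,4) by (intro submanifold_atlas_Times \<Y>_atlas_aff_line) (simp_all add: SO3_atlas_def)
  moreover have "N \<subseteq> A1 \<times> quadrants"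
    using A(4) A1(1) by (auto simp: N_def slice_lift_def)
  ultimately have "(N, ?c) \<in> submanifold_atlas ?P"
    using N submanifold_atlas_restrict by blast
  moreover have "inj_on conj_plane N"
  proof (rule inj_onI)
    fix u v assume uv: "u \<in> N" "v \<in> N" "conj_plane u = conj_plane v"
    then have "twist_map (twist_proj (slice_lift u)) = twist_map (twist_proj (slice_lift v))"
      using twist_map_proj_slice_lift[OF subsetD[OF NP]] by metis
    then have "twist_proj (slice_lift u) = twist_proj (slice_lift v)"
      using uv by (auto simp: N_def dest: inj_onD[OF U(4)])
    then have "slice_lift u = slice_lift v"
      using uv by (auto simp: N_def dest: inj_onD[OF A(6)])
    then show "u = v" using inj_slice_lift by (simp add: inj_eq)
  qed
  moreover have "twist_map ` U' = conj_plane ` N"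
  proof (intro equalityI subsetI)
    fix W assume "W \<in> twist_map ` U'"
    then obtain a where a: "a \<in> A'" "twist_proj a \<in> U'" "W = twist_map (twist_proj a)"
      using U(2) A(1) by blast
    then have "a \<in> SO3 \<times> \<Y>'" using openin_subset[OF A(5)] by (auto simp: topspace_pre_twist)
    then obtain u where "u \<in> ?P" "a = slice_lift u" using slice_lift_image by blast
    then show "W \<in> conj_plane ` N"
      using a by (intro image_eqI[of _ _ u]) (simp_all add: N_def twist_map_proj_slice_lift)
  next
    fix W assume "W \<in> conj_plane ` N"
    then obtain u where "u \<in> N" "W = conj_plane u" by blast
    then show "W \<in> twist_map ` U'"
      by (intro image_eqI[of _ _ "twist_proj (slice_lift u)"])
        (simp_all add: N_def twist_map_proj_slice_lift)
  qed
  moreover have "(\<phi> \<circ> inv_into U' twist_map) (conj_plane u) = ?c u" if "u \<in> N" for u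
  proof -
    have u: "u \<in> ?P" "slice_lift u \<in> A'" "twist_proj (slice_lift u) \<in> U'"
      using that by (simp_all add: N_def)
    have "inv_into U' twist_map (conj_plane u) = twist_proj (slice_lift u)"
      using inv_into_f_f[OF U(4) u(3)] u(1) by (simp add: twist_map_proj_slice_lift)
    moreover have "inv_into A' twist_proj (twist_proj (slice_lift u)) = slice_lift u"
      by (rule inv_into_f_f[OF A(6) u(2)])
    ultimately show ?thesis by (simp add: A(2) A1(2) slice_lift_def map_prod_def split_beta)
  qed
  ultimately have "slice.lifts_to C (N, ?c)" by (simp add: slice.lifts_to_def C)
  then show ?thesis ..
qed

text \<open>A product of a Cayley chart with an affine chart is shrunk until \<open>conj_plane\<close> becomes injective on it.\<close>

lemma \<X>'_charts_cover:
  assumes u: "u \<in> SO3 \<times> quadrants"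
  shows "\<exists>(V, \<xi>)\<in>\<X>'_atlas. conj_plane u \<in> V"
proof -
  let ?P = "SO3 \<times> quadrants"
  obtain N where N: "openin (top_of_set ?P) N" "u \<in> N" "inj_on conj_plane N"
    using slice.locally_injective[OF u] .
  obtain A1 \<phi>1 where A1: "(A1, \<phi>1) \<in> SO3_atlas" "fst u \<in> A1"
    using SO3_atlas_covers[of "fst u"] u by (metis mem_Times_iff)
  obtain B \<psi> where B: "(B, \<psi>) \<in> \<Y>_atlas" by (auto simp: \<Y>_atlas_def)
  define M where "M = N \<inter> A1 \<times> quadrants"
  have "openin (top_of_set SO3) A1"
    using A1(1) unfolding SO3_atlas_def by (rule submanifold_atlasE)
  then have M: "openin (top_of_set ?P) M"
    unfolding M_def using N(1) by (intro openin_Int openin_Times) simp_all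
  have MP: "M \<subseteq> ?P" using openin_imp_subset[OF M] .
  let ?A = "slice_lift ` M"
  have oA: "openin pre_twist_topology ?A"
    using homeomorphic_map_openness[OF homeomorphic_map_slice_lift, of M] M MP by simp
  have cp: "twist_map (twist_proj (slice_lift v)) = conj_plane v" if "v \<in> M" for v
    by (rule twist_map_proj_slice_lift[OF subsetD[OF MP that]])
  have inj: "inj_on twist_proj ?A"
  proof (rule inj_onI)
    fix a b assume "a \<in> ?A" "b \<in> ?A" and ab: "twist_proj a = twist_proj b"
    then obtain v w where v: "v \<in> M" "a = slice_lift v" and w: "w \<in> M" "b = slice_lift w" by blast
    have "conj_plane v = conj_plane w" using ab cp[OF v(1)] cp[OF w(1)] by (simp add: v(2) w(2))
    moreover have "v \<in> N" "w \<in> N" using v(1) w(1) by (simp_all add: M_def)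
    ultimately have "v = w" using inj_onD[OF N(3)] by blast
    then show "a = b" by (simp add: v(2) w(2))
  qed
  have "(A1 \<times> (B \<inter> \<Y>'), map_prod \<phi>1 \<psi>) \<in> prod_atlas SO3_atlas (restrict_atlas \<Y>_atlas \<Y>')"
    unfolding prod_atlas_def restrict_atlas_def using A1(1) B by blast
  moreover have "?A \<subseteq> A1 \<times> (B \<inter> \<Y>')"
    using \<Y>_atlas_aff_line(2)[OF B] by (auto simp: M_def slice_lift_def \<Y>'_eq)
  ultimately have "(twist_proj ` ?A, map_prod \<phi>1 \<psi> \<circ> inv_into ?A twist_proj) \<in> twist_atlas"
    unfolding twist_atlas_def pushforward_atlas_def twist_proj_def[symmetric] using oA inj by blast
  moreover have sub: "twist_proj ` ?A \<subseteq> twist_prod"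
    using MP slice_lift_image unfolding twist_prod_eq by blast
  moreover have im: "twist_map ` twist_proj ` ?A = conj_plane ` M"
    unfolding image_image using cp by (rule image_cong[OF refl])
  moreover have "openin twist_topology (twist_proj ` ?A)"
    using homeomorphic_map_openness[OF homeomorphic_map_twist_map, of "twist_proj ` ?A"] sub im
      slice.openin_T_image[OF M] by (simp add: topspace_twist_topology \<X>'_topology_eq)
  moreover have "inj_on twist_map (twist_proj ` ?A)"
    using bij_betw_twist_map sub by (auto simp: bij_betw_def intro: inj_on_subset)
  ultimately have "(conj_plane ` M, map_prod \<phi>1 \<psi> \<circ> inv_into ?A twist_proj \<circ>
      inv_into (twist_proj ` ?A) twist_map) \<in> \<X>'_atlas"
    unfolding \<X>'_atlas_def pushforward_atlas_def by blast
  moreover have "u \<in> M" using u N(2) A1(2) by (simp add: M_def mem_Times_iff)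
  then have "conj_plane u \<in> conj_plane ` M" by (rule imageI)
  ultimately show ?thesis by blast
qed

lemma smooth_SO3_manifold_\<X>': "smooth_SO3_manifold 5 \<X>'_topology \<X>'_atlas conj_set"
proof -
  have "smooth_manifold DIM((real^3) \<times> (real \<times> real)) \<X>'_topology \<X>'_atlas"
    unfolding \<X>'_topology_eq
    by (rule slice.smooth_manifold_quotient[OF \<X>'_chart_lifts \<X>'_charts_cover])
  then have "smooth_manifold 5 \<X>'_topology \<X>'_atlas" by simp
  moreover have "conj_set k W \<in> \<X>'" if k: "k \<in> SO3" and W: "W \<in> \<X>'" for k W
  proof -
    obtain l L where l: "W = orbit_plane (l, L)" "l \<in> SO3" "L \<in> \<Y>'" using W by (auto simp: \<X>'_eq)
    then have "conj_set k W = orbit_plane (k ** l, L)" using k by (simp add: orbit_plane_mult)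
    then show ?thesis unfolding \<X>'_eq using k l(2,3) by (auto intro: SO3_mult)
  qed
  moreover have "smooth_map (prod_topology SO3_topology \<X>'_topology) (prod_atlas SO3_atlas \<X>'_atlas)
      \<X>'_topology \<X>'_atlas (\<lambda>(k, W). conj_set k W)"
    unfolding \<X>'_topology_eq SO3_topology_def SO3_atlas_def
  proof (rule slice.smooth_map_quotient_action[OF \<X>'_chart_lifts])
    let ?m = "\<lambda>z :: mat3 \<times> mat3 \<times> real \<times> real. (fst z ** fst (snd z), snd (snd z))"
    show "smooth_on (SO3 \<times> SO3 \<times> quadrants) ?m" by (intro smooth_on_intros)
    show "?m ` (SO3 \<times> SO3 \<times> quadrants) \<subseteq> SO3 \<times> quadrants" by (auto simp: SO3_mult)
    show "conj_set k (conj_plane u) = conj_plane (?m (k, u))"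
      if "k \<in> SO3" "u \<in> SO3 \<times> quadrants" for k u
      using that by (auto simp: conj_plane_def conj_set_mult)
  qed
  ultimately show ?thesis
    by (simp add: smooth_SO3_manifold_def topspace_\<X>'_topology conj_set_1 conj_set_mult)
qed

theorem theorem3p2:
  shows "(\<forall>k\<in>SO3. \<forall>Y. line Y \<in> \<Y>' \<longrightarrow>
            twist_map (twist_class k (line Y)) = conj_set k (W_of Y))
       \<and> (\<forall>k\<in>SO3. \<forall>c\<in>twist_prod.
            twist_act k c \<in> twist_prod \<and> twist_map (twist_act k c) = conj_set k (twist_map c))
       \<and> continuous_map twist_topology (subtopology Gr2_topology \<X>') twist_map
       \<and> bij_betw twist_map twist_prod \<X>'
       \<and> topspace \<X>'_topology = \<X>'
       \<and> smooth_SO3_manifold 5 \<X>'_topology \<X>'_atlas conj_set"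
proof (intro conjI ballI allI impI)
  show "twist_map (twist_class k (line Y)) = conj_set k (W_of Y)"
    if "k \<in> SO3" "line Y \<in> \<Y>'" for k Y
    using that by (simp add: twist_map_class orbit_plane_def plane_of_line)
  fix k c assume k: "k \<in> SO3" and "c \<in> twist_prod"
  then obtain l L where c: "c = twist_class l L" "l \<in> SO3" "L \<in> \<Y>'"
    by (auto simp: twist_prod_eq twist_proj_def)
  have act: "twist_act k c = twist_proj (k ** l, L)"
    using k c by (simp add: twist_act_class twist_proj_def)
  show "twist_act k c \<in> twist_prod"
    unfolding act twist_prod_eq using k c by (intro imageI) (simp add: SO3_mult)
  show "twist_map (twist_act k c) = conj_set k (twist_map c)"
    unfolding act using k c by (simp add: twist_map_proj twist_map_class SO3_mult orbit_plane_mult)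
qed (fact continuous_map_twist_map bij_betw_twist_map topspace_\<X>'_topology
    smooth_SO3_manifold_\<X>')+

end
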